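(* Let $D=(V,A)$ be an acyclic digraph whose vertex set $V$ is equipped with a fixed (implicit) linear order, let $(\sigma,\ll)$ be a heavy arc signature of $D$, and let $T,E\subseteq V$. Then there is a unique oriented matroid $\mathcal{O}=(E,\mathcal{C},\mathcal{C}^\ast)$ whose family of signed circuits is $$\mathcal{C}=\left\{\, \pm C_{(\sigma,\ll)}^{(1)} \;\middle|\; C\in \mathcal{C}(\Gamma(D,T,E)) \right\},$$ where $\mathcal{C}(\Gamma(D,T,E))$ denotes the family of circuits of the gammoid $\Gamma(D,T,E)$, and $C_{(\sigma,\ll)}^{(1)}$ is the signature of $C$ with respect to $\Gamma(D,T,E)$, the index $1$, and $(\sigma,\ll)$.
   Context: A digraph is a pair $D=(V,A)$ with $V$ finite and $A\subseteq V\times V$ (loops allowed). A walk is a non-empty sequence $w=w_1w_2\ldots w_n$ of vertices with $(w_i,w_{i+1})\in A$ for $1\le i<n$; $w_{-1}$ denotes its last vertex, $|w|$ its set of vertices, and $|w|_A=\{(w_1,w_2),\ldots,(w_{n-1},w_n)\}$ its set of arcs. A path is a walk without repeated vertices (a single vertex is a path). A cycle is a walk $c_1\ldots c_n$ with $n>1$, $c_1=c_n$ and $c_1\ldots c_{n-1}$ a path (so loops are cycles); $D$ is acyclic if it has no cycle. Routings. For $X,Y\subseteq V$, a routing $R$ from $X$ to $Y$ in $D$ is a family $R$ of paths of $D$ such that every $p\in R$ starts in $X$, each $x\in X$ is the first vertex $p_1$ of some $p\in R$, each $p\in R$ has $p_{-1}\in Y$, and distinct $p,q\in R$ satisfy $|p|\cap|q|=\emptyset$.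 Gammoid. For $T,E\subseteq V$, $\Gamma(D,T,E)$ is the matroid on $E$ whose independent sets are those $X\subseteq E$ for which there is a routing from $X$ to $T$ in $D$. Oriented matroids are triples $(E,\mathcal{C},\mathcal{C}^\ast)$ with ground set $E$, family $\mathcal{C}$ of signed circuits and family $\mathcal{C}^\ast$ of signed cocircuits, satisfying the usual axioms of oriented matroids. A signed subset of $E$ is a map $E\to\{-1,0,1\}$, and $-X$ denotes the pointwise negation. Heavy arc signature. A heavy arc signature of $D=(V,A)$ is a pair $(\sigma,\ll)$ where $\sigma\colon A\to\{-1,1\}$ is a map and $\ll$ is a linear order on $A$. Routing order. For a routing $R$ put $R_A=\bigcup_{p\in R}|p|_A$. For routings $Q,R$ write $Q\lll R$ if the $\ll$-maximal element of the symmetric difference $Q_A\bigtriangleup R_A$ belongs to $R_A$. For a fixed set $X$, a routing from $X$ to $T$ is determined by its arc set, so $\lll$ is a (strict) linear order on the routings from $X$ to $T$. Sign of a routing. Let $R$ be a routing from $X=\{x_1,\ldots,x_n\}$ to $Y=\{y_1,\ldots,y_m\}$, both listed without repetition in their implicit orders. Let $\varphi\colon\{1,\ldots,n\}\to\{1,\ldots,m\}$ be the unique map such that for every $i$ there is $p\in R$ with $p_1=x_i$ and $p_{-1}=y_{\varphi(i)}$. Then $$\operatorname{sgn}_\sigma(R)=\operatorname{sgn}(\varphi)\cdot\prod_{p\in R,\ a\in|p|_A}\sigma(a),\qquad \operatorname{sgn}(\varphi)=(-1)^{|\{(i,j)\,:\, i<j,\ \varphi(i)>\varphi(j)\}|}.$$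 Signature of a circuit. Let $V$ be linearly ordered, with all subsets of $V$ (in particular $T$, $E$ and circuits) inheriting the order. Let $C=\{c_1,\ldots,c_m\}$ be a circuit of $M=\Gamma(D,T,E)$, listed without repetition in increasing order, and let $i\in\{1,\ldots,m\}$. For $k\in\{1,\ldots,m\}$ let $R_k$ be the unique $\lll$-maximal routing from $C\setminus\{c_k\}$ to $T$ in $D$. The signature of $C$ with respect to $M$, $i$ and $(\sigma,\ll)$ is the signed subset $C^{(i)}_{(\sigma,\ll)}$ of $E$ with $$C^{(i)}_{(\sigma,\ll)}(e)=\begin{cases}0 & \text{if } e\notin C,\\ -\operatorname{sgn}_\sigma(R_i) & \text{if } e=c_i,\\ (-1)^{i-j+1}\operatorname{sgn}_\sigma(R_j) & \text{if } e=c_j\neq c_i.\end{cases}$$ *)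

theory Defs
  imports "Graph_Theory.Pair_Digraph" "Graph_Theory.Vertex_Walk"
begin

section \<open>Walks, cycles and routings\<close>

text \<open>
  A digraph \<open>(V, A)\<close> with \<open>V\<close> finite, \<open>A \<subseteq> V \<times> V\<close> and loops allowed is a
  \<^typ>\<open>'v pair_pre_digraph\<close> satisfying \<^locale>\<open>pair_fin_digraph\<close>. A walk is a
  \<^const>\<open>vwalk\<close> (a non-empty list of vertices), a path is a \<^const>\<open>vpath\<close>, and the
  set of arcs of a walk \<open>w\<close> is \<open>set (vwalk_arcs w)\<close>.
\<close>

definition vcycle :: "'v pair_pre_digraph \<Rightarrow> 'v list \<Rightarrow> bool" where
  "vcycle D c \<longleftrightarrow> vwalk c (with_proj D) \<and> length c > 1 \<and> hd c = last c
     \<and> vpath (butlast c) (with_proj D)"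

definition acyclic_digraph :: "'v pair_pre_digraph \<Rightarrow> bool" where
  "acyclic_digraph D \<longleftrightarrow> (\<nexists>c. vcycle D c)"

definition routing :: "'v pair_pre_digraph \<Rightarrow> 'v set \<Rightarrow> 'v set \<Rightarrow> 'v list set \<Rightarrow> bool" where
  "routing D X Y R \<longleftrightarrow>
     (\<forall>p\<in>R. vpath p (with_proj D) \<and> hd p \<in> X \<and> last p \<in> Y)
     \<and> (\<forall>x\<in>X. \<exists>p\<in>R. hd p = x)
     \<and> (\<forall>p\<in>R. \<forall>q\<in>R. p \<noteq> q \<longrightarrow> set p \<inter> set q = {})"


section \<open>Matroids and gammoids\<close>

record 'a matroid_data =
  ground :: "'a set"
  indeps :: "'a set set"

definition circuits :: "'a matroid_data \<Rightarrow> 'a set set" where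
  "circuits M = {C. C \<subseteq> ground M \<and> C \<notin> indeps M \<and> (\<forall>B. B \<subset> C \<longrightarrow> B \<in> indeps M)}"

definition bases :: "'a matroid_data \<Rightarrow> 'a set set" where
  "bases M = {B \<in> indeps M. \<forall>X\<in>indeps M. B \<subseteq> X \<longrightarrow> X = B}"

definition dual_matroid :: "'a matroid_data \<Rightarrow> 'a matroid_data" where
  "dual_matroid M = \<lparr> ground = ground M,
     indeps = {X. X \<subseteq> ground M \<and> (\<exists>B\<in>bases M. X \<subseteq> ground M - B)} \<rparr>"

definition gammoid :: "'v pair_pre_digraph \<Rightarrow> 'v set \<Rightarrow> 'v set \<Rightarrow> 'v matroid_data" where
  "gammoid D T E = \<lparr> ground = E, indeps = {X. X \<subseteq> E \<and> (\<exists>R. routing D X T R)} \<rparr>"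


section \<open>Oriented matroids\<close>

text \<open>
  A signed subset of \<open>E\<close>, that is a map from \<open>E\<close> to \<open>{-1, 0, 1}\<close>, is represented by
  its extension by \<open>0\<close> to the whole type, so that signed subsets of \<open>E\<close> are equal iff
  they agree on \<open>E\<close>. Negation \<open>- X\<close> is the pointwise one.
\<close>

definition signed_subset :: "'a set \<Rightarrow> ('a \<Rightarrow> int) \<Rightarrow> bool" where
  "signed_subset E X \<longleftrightarrow> (\<forall>e. X e \<in> {-1, 0, 1}) \<and> (\<forall>e. e \<notin> E \<longrightarrow> X e = 0)"

definition pos_part :: "('a \<Rightarrow> int) \<Rightarrow> 'a set" where
  "pos_part X = {e. X e = 1}"

definition neg_part :: "('a \<Rightarrow> int) \<Rightarrow> 'a set" where
  "neg_part X = {e. X e = -1}"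

definition signed_support :: "('a \<Rightarrow> int) \<Rightarrow> 'a set" where
  "signed_support X = {e. X e \<noteq> 0}"

definition orthogonal_signed :: "('a \<Rightarrow> int) \<Rightarrow> ('a \<Rightarrow> int) \<Rightarrow> bool" where
  "orthogonal_signed X Y \<longleftrightarrow>
     signed_support X \<inter> signed_support Y = {} \<or> ((\<exists>e. X e * Y e = 1) \<and> (\<exists>f. X f * Y f = -1))"

definition signed_circuit_axioms :: "'a set \<Rightarrow> ('a \<Rightarrow> int) set \<Rightarrow> bool" where
  "signed_circuit_axioms E \<C> \<longleftrightarrow>
     (\<forall>X\<in>\<C>. signed_subset E X)
     \<and> (\<forall>X\<in>\<C>. signed_support X \<noteq> {})
     \<and> (\<forall>X\<in>\<C>. - X \<in> \<C>)
     \<and> (\<forall>X\<in>\<C>. \<forall>Y\<in>\<C>. signed_support X \<subseteq> signed_support Y \<longrightarrow> X = Y \<or> X = - Y)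
     \<and> (\<forall>X\<in>\<C>. \<forall>Y\<in>\<C>. \<forall>e. X \<noteq> - Y \<and> e \<in> pos_part X \<inter> neg_part Y \<longrightarrow>
          (\<exists>Z\<in>\<C>. pos_part Z \<subseteq> (pos_part X \<union> pos_part Y) - {e}
               \<and> neg_part Z \<subseteq> (neg_part X \<union> neg_part Y) - {e}))"

record 'a oriented_matroid_data =
  om_ground :: "'a set"
  signed_circuits :: "('a \<Rightarrow> int) set"
  signed_cocircuits :: "('a \<Rightarrow> int) set"

definition underlying_matroid :: "'a oriented_matroid_data \<Rightarrow> 'a matroid_data" where
  "underlying_matroid \<O> = \<lparr> ground = om_ground \<O>,
     indeps = {X. X \<subseteq> om_ground \<O> \<and> (\<forall>C\<in>signed_circuits \<O>. \<not> signed_support C \<subseteq> X)} \<rparr>"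

text \<open>
  The axioms for the triple \<open>(E, \<C>, \<C>\<^sup>*)\<close> are redundant: orthogonality of two such
  signatures of circuits and cocircuits already gives weak elimination, and conversely \<open>\<C>\<close>
  determines \<open>\<C>\<^sup>*\<close>. All are kept, so that each of the usual axiomatisations is covered.
\<close>

definition oriented_matroid :: "'a oriented_matroid_data \<Rightarrow> bool" where
  "oriented_matroid \<O> \<longleftrightarrow>
     finite (om_ground \<O>)
     \<and> signed_circuit_axioms (om_ground \<O>) (signed_circuits \<O>)
     \<and> signed_circuit_axioms (om_ground \<O>) (signed_cocircuits \<O>)
     \<and> signed_support ` signed_cocircuits \<O> = circuits (dual_matroid (underlying_matroid \<O>))
     \<and> (\<forall>X\<in>signed_circuits \<O>. \<forall>Y\<in>signed_cocircuits \<O>. orthogonal_signed X Y)"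


section \<open>Heavy arc signatures\<close>

definition heavy_arc_signature ::
    "'v pair_pre_digraph \<Rightarrow> ('v \<times> 'v \<Rightarrow> int) \<Rightarrow> ('v \<times> 'v) rel \<Rightarrow> bool" where
  "heavy_arc_signature D \<sigma> lo \<longleftrightarrow>
     (\<forall>a\<in>parcs D. \<sigma> a \<in> {-1, 1}) \<and> linear_order_on (parcs D) lo"

definition routing_arcs :: "'v list set \<Rightarrow> ('v \<times> 'v) set" where
  "routing_arcs R = (\<Union>p\<in>R. set (vwalk_arcs p))"

definition routing_less :: "('v \<times> 'v) rel \<Rightarrow> 'v list set \<Rightarrow> 'v list set \<Rightarrow> bool" where
  "routing_less lo Q R \<longleftrightarrow>
     (\<exists>a \<in> sym_diff (routing_arcs Q) (routing_arcs R).
        (\<forall>b \<in> sym_diff (routing_arcs Q) (routing_arcs R). (b, a) \<in> lo) \<and> a \<in> routing_arcs R)"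

definition max_routing ::
    "'v pair_pre_digraph \<Rightarrow> ('v \<times> 'v) rel \<Rightarrow> 'v set \<Rightarrow> 'v set \<Rightarrow> 'v list set" where
  "max_routing D lo X Y = (THE R. routing D X Y R \<and> (\<nexists>Q. routing D X Y Q \<and> routing_less lo R Q))"

text \<open>
  The \<open>i\<close>-th smallest element of a finite set, counting from \<open>1\<close>. The linear order on the
  vertices is the one of the vertex type.
\<close>

definition nth_elem :: "'v::linorder set \<Rightarrow> nat \<Rightarrow> 'v" where
  "nth_elem X i = sorted_list_of_set X ! (i - 1)"

definition elem_index :: "'v::linorder set \<Rightarrow> 'v \<Rightarrow> nat" where
  "elem_index X x = (THE i. i \<in> {1..card X} \<and> nth_elem X i = x)"

definition routing_map :: "'v::linorder set \<Rightarrow> 'v set \<Rightarrow> 'v list set \<Rightarrow> nat \<Rightarrow> nat" where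
  "routing_map X Y R i =
     (THE j. j \<in> {1..card Y} \<and> (\<exists>p\<in>R. hd p = nth_elem X i \<and> last p = nth_elem Y j))"

definition map_sign :: "nat \<Rightarrow> (nat \<Rightarrow> nat) \<Rightarrow> int" where
  "map_sign n \<phi> = (-1) ^ card {(i, j). i \<in> {1..n} \<and> j \<in> {1..n} \<and> i < j \<and> \<phi> i > \<phi> j}"

definition routing_sign ::
    "('v::linorder \<times> 'v \<Rightarrow> int) \<Rightarrow> 'v set \<Rightarrow> 'v set \<Rightarrow> 'v list set \<Rightarrow> int" where
  "routing_sign \<sigma> X Y R =
     map_sign (card X) (routing_map X Y R) * (\<Prod>p\<in>R. \<Prod>a\<in>set (vwalk_arcs p). \<sigma> a)"

text \<open>
  The index \<open>i\<close> counts from \<open>1\<close>. The exponent \<open>i + j + 1\<close> has the parity of \<open>i - j + 1\<close> and avoids truncated subtraction.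
\<close>

definition circuit_signature ::
    "'v::linorder pair_pre_digraph \<Rightarrow> 'v set \<Rightarrow> ('v \<times> 'v \<Rightarrow> int) \<Rightarrow> ('v \<times> 'v) rel
      \<Rightarrow> nat \<Rightarrow> 'v set \<Rightarrow> 'v \<Rightarrow> int" where
  "circuit_signature D T \<sigma> lo i C e =
     (let s = \<lambda>k. routing_sign \<sigma> (C - {nth_elem C k}) T
                    (max_routing D lo (C - {nth_elem C k}) T)
      in if e \<notin> C then 0
         else if e = nth_elem C i then - s i
         else let j = elem_index C e in (-1) ^ (i + j + 1) * s j)"

end

theory Submission
  imports Defs Complex_Main "HOL-Combinatorics.Permutations"
begin

text \<open>
  The signed circuits in question are the sign vectors of the linear dependencies of a concrete
  real configuration, so that the oriented matroid axioms come for free from linear algebra.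

  Give the arc \<open>a\<close> with \<open>r\<close> predecessors in the order of the arcs the weight
  \<open>\<sigma> a * 3 ^ (2 ^ r)\<close>, let \<open>W\<close> be the weighted adjacency matrix of \<open>D\<close> and \<open>N = I - W\<close>. A
  \<^emph>\<open>dependency\<close> is a vector \<open>z\<^sup>T N\<close> with \<open>z\<close> zero on \<open>T\<close>. As \<open>N\<close> is the inverse of the matrix
  of weighted path sums, a dependency is the same as a linear relation between the vectors
  that record, for a vertex, the weighted paths from it to each element of \<open>T\<close>; but \<open>N\<close> has the
  advantage that no path needs to be summed.

  Routings enter through determinants. For an injection \<open>\<tau> : X \<rightarrow> T\<close> replace in \<open>N\<close> each
  column \<open>x \<in> X\<close> by the unit vector at \<open>\<tau> x\<close>. A permutation contributes to the Leibniz expansion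
  iff it sends every \<open>x \<in> X\<close> to \<open>\<tau> x\<close> and every other vertex to itself or back along an arc. Since
  \<open>D\<close> is acyclic, the arcs followed backwards are then exactly those of a routing from \<open>X\<close> onto
  \<open>\<tau> X\<close>, and every routing arises in this way (\<open>routing_of_linking_perm\<close>, \<open>linking_perm_of_routing\<close>). Its
  term is, up to sign, \<open>3\<close> to the sum of \<open>2 ^ r\<close> over its arcs. Read in binary, these sums are
  ordered precisely as the routings are, and being distinct powers of three,
  the terms of all other routings together have less than half the absolute value of the greatest one.
  Hence, if \<open>\<tau>\<close> maps onto the ends of the maximal routing from \<open>X\<close> to \<open>T\<close>, the determinant is nonzero and
  that routing determines its sign, which is \<open>sgn\<^sub>\<sigma>\<close> if \<open>\<tau>\<close> is increasing (\<open>link_det_dominant\<close>). By Cramer's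
  rule the gammoid is therefore the matroid of dependencies (\<open>gammoid_indeps\<close>).

  It remains to compare signs. Let \<open>x\<close> be a dependency with support the circuit \<open>C\<close>. For distinct
  \<open>j, k \<in> C\<close> the determinants of \<open>(C - k, \<tau>)\<close> and \<open>(C - j, \<tau> \<circ> (j k))\<close> are in the ratio
  \<open>- x k : x j\<close> (\<open>link_det_exchange\<close>), whatever \<open>\<tau>\<close> is. Comparing absolute values for two choices of
  \<open>\<tau>\<close>, the maximal routings from \<open>C - k\<close> and from \<open>C - j\<close> must end in the same subset of \<open>T\<close>
  (\<open>circuit_ends_agree\<close>). If \<open>j, k\<close> are neighbours in \<open>C\<close> then \<open>\<tau> \<circ> (j k)\<close> is increasing along
  with \<open>\<tau>\<close>, so that \<open>x j\<close> and \<open>x k\<close> are related by the signs of these two maximal routings and one change of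
  sign (\<open>adjacent_signs\<close>). Running through \<open>C\<close> in increasing order produces the alternating
  sign \<open>(-1)\<^sup>j\<close> of the circuit signature.

  Finally, for every subspace of \<open>\<real>\<^sup>E\<close> the sign vectors of the nonzero vectors of minimal support are the circuits of
  exactly one oriented matroid (\<open>ex1_oriented_matroid\<close>): the orthogonal complement supplies the
  cocircuits, and orthogonality with the circuits leaves no choice for them.
\<close>

section \<open>Sign vectors of a coordinate subspace\<close>

definition vsupp :: "('a \<Rightarrow> real) \<Rightarrow> 'a set" where
  "vsupp x = {e. x e \<noteq> 0}"

definition sign_vec :: "('a \<Rightarrow> real) \<Rightarrow> 'a \<Rightarrow> int" where
  "sign_vec x e = (if x e > 0 then 1 else if x e < 0 then -1 else 0)"

definition elementary :: "('a \<Rightarrow> real) set \<Rightarrow> ('a \<Rightarrow> real) \<Rightarrow> bool" where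
  "elementary L x \<longleftrightarrow> x \<in> L \<and> vsupp x \<noteq> {} \<and> (\<forall>y\<in>L. vsupp y \<subset> vsupp x \<longrightarrow> vsupp y = {})"

definition orth_complement :: "'a set \<Rightarrow> ('a \<Rightarrow> real) set \<Rightarrow> ('a \<Rightarrow> real) set" where
  "orth_complement E L = {y. vsupp y \<subseteq> E \<and> (\<forall>x\<in>L. (\<Sum>e\<in>E. x e * y e) = 0)}"

definition free_sets :: "'a set \<Rightarrow> ('a \<Rightarrow> real) set \<Rightarrow> 'a set set" where
  "free_sets E L = {X. X \<subseteq> E \<and> (\<forall>x\<in>L. vsupp x \<subseteq> X \<longrightarrow> vsupp x = {})}"

lemma elementaryD:
  assumes "elementary L x"
  shows "x \<in> L" "vsupp x \<noteq> {}" "y \<in> L \<Longrightarrow> vsupp y \<subset> vsupp x \<Longrightarrow> vsupp y = {}"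
  using assms unfolding elementary_def by blast+

lemma vsupp_nonemptyE:
  assumes "vsupp x \<noteq> {}"
  obtains e where "x e \<noteq> 0"
  using assms by (auto simp: vsupp_def)

lemma sign_vec_uminus: "sign_vec (\<lambda>e. - x e) = - sign_vec x"
  by (auto simp: sign_vec_def fun_eq_iff)

lemma sign_vec_scale: "sign_vec (\<lambda>e. c * x e) = (if c > 0 then sign_vec x else if c < 0 then - sign_vec x else (\<lambda>_. 0))"
  by (auto simp: sign_vec_def fun_eq_iff zero_less_mult_iff mult_less_0_iff)

lemma signed_support_sign_vec [simp]: "signed_support (sign_vec x) = vsupp x"
  by (auto simp: signed_support_def sign_vec_def vsupp_def split: if_splits)

lemma pos_part_sign_vec: "pos_part (sign_vec x) = {e. x e > 0}"
  and neg_part_sign_vec: "neg_part (sign_vec x) = {e. x e < 0}"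
  by (auto simp: pos_part_def neg_part_def sign_vec_def split: if_splits)

text \<open>
  The ambient space \<open>\<real>\<^sup>E\<close> is represented by the real functions that vanish outside \<open>E\<close>, in keeping
  with the representation of signed subsets.
\<close>
locale coordinate_subspace =
  fixes E :: "'a set" and L :: "('a \<Rightarrow> real) set"
  assumes finite_E: "finite E"
    and supp_subset: "x \<in> L \<Longrightarrow> vsupp x \<subseteq> E"
    and zero_in: "(\<lambda>_. 0) \<in> L"
    and combine: "x \<in> L \<Longrightarrow> y \<in> L \<Longrightarrow> (\<lambda>e. a * x e + b * y e) \<in> L"
begin

lemma scale: "x \<in> L \<Longrightarrow> (\<lambda>e. c * x e) \<in> L"
  using combine[of x x c 0] by simp

lemma sum_in:
  assumes "finite F" "\<And>f. f \<in> F \<Longrightarrow> X f \<in> L"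
  shows "(\<lambda>e. \<Sum>f\<in>F. c f * X f e) \<in> L"
  using assms
proof (induction F rule: finite_induct)
  case empty
  then show ?case using zero_in by simp
next
  case (insert f F)
  then show ?case using combine[of "X f" "\<lambda>e. \<Sum>f\<in>F. c f * X f e" "c f" 1] by simp
qed

lemma finite_vsupp: "x \<in> L \<Longrightarrow> finite (vsupp x)"
  using supp_subset finite_E finite_subset by blast

lemma orth_subspace: "coordinate_subspace E (orth_complement E L)"
proof
  show "finite E" by (rule finite_E)
  show "(\<lambda>_. 0) \<in> orth_complement E L" by (simp add: orth_complement_def vsupp_def)
  fix x y :: "'a \<Rightarrow> real" and a b :: real
  assume xy: "x \<in> orth_complement E L" "y \<in> orth_complement E L"
  have "(\<Sum>e\<in>E. z e * (a * x e + b * y e)) = 0" if "z \<in> L" for z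
  proof -
    have "(\<Sum>e\<in>E. z e * (a * x e + b * y e)) = a * (\<Sum>e\<in>E. z e * x e) + b * (\<Sum>e\<in>E. z e * y e)"
      by (simp add: sum_distrib_left sum.distrib algebra_simps)
    then show ?thesis using xy that by (simp add: orth_complement_def)
  qed
  moreover have "vsupp (\<lambda>e. a * x e + b * y e) \<subseteq> vsupp x \<union> vsupp y" by (auto simp: vsupp_def)
  ultimately show "(\<lambda>e. a * x e + b * y e) \<in> orth_complement E L"
    using xy by (simp add: orth_complement_def) blast
next
  fix x assume "x \<in> orth_complement E L" then show "vsupp x \<subseteq> E"
    by (simp add: orth_complement_def)
qed

text \<open>
  If \<open>x\<close> itself is not elementary, some vector \<open>y\<close> of the subspace has smaller nonempty support. Moving
  from \<open>x\<close> in the direction \<open>- y\<close> until the first coordinate vanishes changes no sign of \<open>x\<close>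
  to the opposite one and strictly shrinks the support. This is what makes sign vectors satisfy
  circuit elimination.
\<close>
lemma conformal_elementary:
  assumes "x \<in> L" "vsupp x \<noteq> {}"
  shows "\<exists>z. elementary L z \<and> {e. z e > 0} \<subseteq> {e. x e > 0} \<and> {e. z e < 0} \<subseteq> {e. x e < 0}"
  using assms
proof (induction "card (vsupp x)" arbitrary: x rule: less_induct)
  case less
  show ?case
  proof (cases "elementary L x")
    case True
    then show ?thesis by blast
  next
    case False
    then obtain y0 where y0: "y0 \<in> L" "vsupp y0 \<subset> vsupp x" "vsupp y0 \<noteq> {}"
      using less.prems by (auto simp: elementary_def)
    obtain e0 where e0: "y0 e0 \<noteq> 0" using y0(3) by (auto simp: vsupp_def)
    then have x0: "x e0 \<noteq> 0" using y0(2) by (auto simp: vsupp_def)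
    \<comment> \<open>The factor orients the direction such that it agrees in sign with x at e0,
      so that the set F of coordinates that can vanish is not empty.\<close>
    define y where "y = (\<lambda>e. (x e0 * y0 e0) * y0 e)"
    have yL: "y \<in> L" unfolding y_def by (rule scale[OF y0(1)])
    have ys: "vsupp y = vsupp y0" using e0 x0 by (auto simp: vsupp_def y_def)
    have "x e0 * y e0 = (x e0 * y0 e0)^2" by (simp add: y_def power2_eq_square)
    then have pos0: "x e0 * y e0 > 0" using e0 x0 by simp
    define F where "F = {e. x e * y e > 0}"
    have "F \<subseteq> vsupp x" by (auto simp: F_def vsupp_def)
    then have finF: "finite F" using finite_vsupp[OF less.prems(1)] finite_subset by blast
    have "F \<noteq> {}" using pos0 by (auto simp: F_def)
    define m where "m = arg_min_on (\<lambda>e. x e / y e) F"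
    have m: "m \<in> F" "\<And>e. e \<in> F \<Longrightarrow> x m / y m \<le> x e / y e"
      unfolding m_def using arg_min_if_finite(1)[OF finF \<open>F \<noteq> {}\<close>] arg_min_least[OF finF \<open>F \<noteq> {}\<close>] by auto
    define r where "r = x m / y m"
    have rpos: "r > 0" using m(1) by (auto simp: r_def F_def zero_less_mult_iff zero_less_divide_iff)
    define x' where "x' = (\<lambda>e. 1 * x e + (- r) * y e)"
    have x'L: "x' \<in> L" unfolding x'_def by (rule combine[OF less.prems(1) yL])
    have xm: "x' m = 0" "x m \<noteq> 0" using m(1) by (auto simp: x'_def r_def F_def)
    have key: "(x' e > 0 \<longrightarrow> x e > 0) \<and> (x' e < 0 \<longrightarrow> x e < 0)" for e
    proof -
      consider "e \<in> F" | "x e * y e \<le> 0" by (force simp: F_def)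
      then show ?thesis
      proof cases
        case 1
        then have "r \<le> x e / y e" using m(2) by (simp add: r_def)
        moreover have "(x e > 0 \<and> y e > 0) \<or> (x e < 0 \<and> y e < 0)"
          using 1 by (auto simp: F_def zero_less_mult_iff)
        ultimately show ?thesis by (auto simp: x'_def field_simps)
      next
        case 2
        have "y e \<noteq> 0 \<Longrightarrow> x e \<noteq> 0" using ys y0(2) by (auto simp: vsupp_def)
        then have "(x e > 0 \<and> y e \<le> 0) \<or> (x e < 0 \<and> y e \<ge> 0) \<or> (x e = 0 \<and> y e = 0)"
          using 2 by (auto simp: mult_le_0_iff)
        then show ?thesis
          using mult_nonneg_nonneg[OF less_imp_le[OF rpos], of "y e"]
            mult_nonneg_nonpos[OF less_imp_le[OF rpos], of "y e"]
          unfolding x'_def by auto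
      qed
    qed
    have sub: "vsupp x' \<subseteq> vsupp x"
    proof
      fix e assume "e \<in> vsupp x'"
      then have "x' e > 0 \<or> x' e < 0" by (auto simp: vsupp_def)
      then show "e \<in> vsupp x" using key[of e] by (auto simp: vsupp_def)
    qed
    have "vsupp x' \<subset> vsupp x" using sub xm by (auto simp: vsupp_def)
    then have card: "card (vsupp x') < card (vsupp x)"
      using finite_vsupp[OF less.prems(1)] psubset_card_mono by blast
    obtain f where "x f \<noteq> 0" "y f = 0" using y0(2) ys by (auto simp: vsupp_def)
    then have "x' f \<noteq> 0" by (simp add: x'_def)
    then have "vsupp x' \<noteq> {}" by (auto simp: vsupp_def)
    from less.hyps[OF card x'L this] obtain z where z: "elementary L z"
      "{e. z e > 0} \<subseteq> {e. x' e > 0}" "{e. z e < 0} \<subseteq> {e. x' e < 0}" by blast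
    then show ?thesis using key by blast
  qed
qed

lemma elementary_unique:
  assumes "elementary L y" "x \<in> L" "vsupp x \<subseteq> vsupp y"
  shows "\<exists>c. x = (\<lambda>e. c * y e)"
proof -
  obtain e where e: "y e \<noteq> 0" using elementaryD(2)[OF assms(1)] by (rule vsupp_nonemptyE)
  define d where "d = (\<lambda>f. 1 * x f + (- (x e / y e)) * y f)"
  have yL: "y \<in> L" using assms(1) by (simp add: elementary_def)
  have "d \<in> L" unfolding d_def by (rule combine[OF assms(2) yL])
  moreover have "vsupp d \<subset> vsupp y"
  proof
    show "vsupp d \<subseteq> vsupp y" using assms(3) by (fastforce simp: vsupp_def d_def)
    have "d e = 0" using e by (simp add: d_def)
    then show "vsupp d \<noteq> vsupp y" using e by (auto simp: vsupp_def)
  qed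
  ultimately have "vsupp d = {}" by (rule elementaryD(3)[OF assms(1)])
  then have d0: "d f = 0" for f by (auto simp: vsupp_def)
  have "x f = (x e / y e) * y f" for f using d0[of f] by (simp add: d_def)
  then show ?thesis by blast
qed

lemma elementary_scale:
  assumes "elementary L x" "c \<noteq> 0"
  shows "elementary L (\<lambda>e. c * x e)"
proof -
  have "vsupp (\<lambda>e. c * x e) = vsupp x" using assms(2) by (auto simp: vsupp_def)
  then show ?thesis using assms(1) scale by (simp add: elementary_def)
qed

text \<open>
  For elimination, the positive combination of the two vectors that cancels the given coordinate has only signs
  occurring in one of them; an elementary vector conforming to it is as required.
\<close>
lemma sign_circuit_axioms:
  "signed_circuit_axioms E (sign_vec ` {x. elementary L x})"
  unfolding signed_circuit_axioms_def
proof (intro conjI ballI allI impI)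
  fix X assume "X \<in> sign_vec ` {x. elementary L x}"
  then obtain x where x: "elementary L x" "X = sign_vec x" by auto
  have "vsupp x \<subseteq> E" using x supp_subset by (simp add: elementary_def)
  then show "signed_subset E X"
    unfolding x(2) by (auto simp: signed_subset_def sign_vec_def vsupp_def)
  show "signed_support X \<noteq> {}" using x by (simp add: elementary_def)
  show "- X \<in> sign_vec ` {x. elementary L x}"
    using elementary_scale[OF x(1), of "-1"] unfolding x(2) sign_vec_uminus[of x, symmetric] by simp
next
  fix X Y assume "X \<in> sign_vec ` {x. elementary L x}" "Y \<in> sign_vec ` {x. elementary L x}"
    and sub: "signed_support X \<subseteq> signed_support Y"
  then obtain x y where xy: "elementary L x" "X = sign_vec x" "elementary L y" "Y = sign_vec y" by auto
  then obtain c where c: "x = (\<lambda>e. c * y e)"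
    using elementary_unique[of y x] elementaryD(1)[OF xy(1)] sub by auto
  then have "c \<noteq> 0" using elementaryD(2)[OF xy(1)] by (auto simp: vsupp_def)
  then show "X = Y \<or> X = - Y"
    using c sign_vec_scale[of c y] xy by auto
next
  fix X Y e assume "X \<in> sign_vec ` {x. elementary L x}" "Y \<in> sign_vec ` {x. elementary L x}"
    and H: "X \<noteq> - Y \<and> e \<in> pos_part X \<inter> neg_part Y"
  then obtain x y where xy: "elementary L x" "X = sign_vec x" "elementary L y" "Y = sign_vec y" by auto
  have e: "x e > 0" "y e < 0" using H xy by (auto simp: pos_part_sign_vec neg_part_sign_vec)
  define w where "w = (\<lambda>f. (- y e) * x f + x e * y f)"
  have wL: "w \<in> L" unfolding w_def using combine elementaryD(1) xy(1,3) by blast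
  have "vsupp w \<noteq> {}"
  proof
    assume "vsupp w = {}"
    then have w0: "w f = 0" for f by (auto simp: vsupp_def)
    have "x f = (x e / y e) * y f" for f using w0[of f] e
      by (simp add: w_def field_simps)
    then have "x = (\<lambda>f. (x e / y e) * y f)" by blast
    moreover have "x e / y e < 0" using e by (simp add: divide_pos_neg)
    ultimately show False using H xy sign_vec_scale[of "x e / y e" y] by (metis not_less_iff_gr_or_eq)
  qed
  then obtain z where z: "elementary L z" "{e. z e > 0} \<subseteq> {e. w e > 0}" "{e. z e < 0} \<subseteq> {e. w e < 0}"
    using conformal_elementary[OF wL] by blast
  have we: "w e = 0" by (simp add: w_def)
  have wpos: "x f > 0 \<or> y f > 0" if "w f > 0" for f
    using that e mult_nonneg_nonpos[of "- y e" "x f"] mult_nonneg_nonpos[of "x e" "y f"]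
    unfolding w_def by linarith
  have wneg: "x f < 0 \<or> y f < 0" if "w f < 0" for f
    using that e mult_nonneg_nonneg[of "- y e" "x f"] mult_nonneg_nonneg[of "x e" "y f"]
    unfolding w_def by linarith
  show "\<exists>Z\<in>sign_vec ` {x. elementary L x}.
       pos_part Z \<subseteq> pos_part X \<union> pos_part Y - {e} \<and> neg_part Z \<subseteq> neg_part X \<union> neg_part Y - {e}"
  proof (intro bexI conjI subsetI)
    show "sign_vec z \<in> sign_vec ` {x. elementary L x}" using z(1) by blast
    fix f
    show "f \<in> pos_part (sign_vec z) \<Longrightarrow> f \<in> pos_part X \<union> pos_part Y - {e}"
      using z(2) we wpos[of f] xy by (auto simp: pos_part_sign_vec)
    show "f \<in> neg_part (sign_vec z) \<Longrightarrow> f \<in> neg_part X \<union> neg_part Y - {e}"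
      using z(3) we wneg[of f] xy by (auto simp: neg_part_sign_vec)
  qed
qed

text \<open>
  The passage from supports of vectors to matroid circuits. It is used for the gammoid and, applied
  to the orthogonal complement, for the dual matroid.
\<close>
lemma circuits_free_sets:
  assumes "ground M = E" "indeps M = free_sets E L"
  shows "circuits M = vsupp ` {x. elementary L x}"
proof (intro set_eqI iffI)
  fix C assume "C \<in> circuits M"
  then have C: "C \<subseteq> E" "C \<notin> free_sets E L" "\<And>B. B \<subset> C \<Longrightarrow> B \<in> free_sets E L"
    using assms by (auto simp: circuits_def)
  then obtain x where x: "x \<in> L" "vsupp x \<subseteq> C" "vsupp x \<noteq> {}" by (auto simp: free_sets_def)
  have "vsupp x = C"
  proof (rule ccontr)
    assume "vsupp x \<noteq> C"
    then have "vsupp x \<in> free_sets E L" using x C(3) by blast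
    then show False using x by (auto simp: free_sets_def)
  qed
  moreover have "vsupp y = {}" if "y \<in> L" "vsupp y \<subset> C" for y
    using C(3)[OF that(2)] that by (auto simp: free_sets_def)
  ultimately have "elementary L x" using x unfolding elementary_def by blast
  then show "C \<in> vsupp ` {x. elementary L x}" using \<open>vsupp x = C\<close> by blast
next
  fix C assume "C \<in> vsupp ` {x. elementary L x}"
  then obtain x where x: "elementary L x" "C = vsupp x" by auto
  have "B \<in> free_sets E L" if "B \<subset> C" for B
    unfolding free_sets_def
    using that x(2) supp_subset[OF elementaryD(1)[OF x(1)]] elementaryD(3)[OF x(1)] by blast
  moreover have "C \<notin> free_sets E L"
    using x(2) elementaryD(1,2)[OF x(1)] by (auto simp: free_sets_def)
  ultimately show "C \<in> circuits M"
    using assms x(2) supp_subset[OF elementaryD(1)[OF x(1)]] by (simp add: circuits_def)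
qed

text \<open>
  The underlying matroid only sees elementary vectors; every nonempty support contains
  the support of an elementary vector by conformal elimination.
\<close>
lemma underlying_matroid_free_sets:
  assumes "om_ground \<O> = E" "signed_circuits \<O> = sign_vec ` {x. elementary L x}"
  shows "ground (underlying_matroid \<O>) = E" "indeps (underlying_matroid \<O>) = free_sets E L"
proof -
  show "ground (underlying_matroid \<O>) = E" using assms by (simp add: underlying_matroid_def)
  have ex: "\<exists>z. elementary L z \<and> vsupp z \<subseteq> vsupp x" if x: "x \<in> L" "vsupp x \<noteq> {}" for x
  proof -
    obtain z where z: "elementary L z" "{e. z e > 0} \<subseteq> {e. x e > 0}" "{e. z e < 0} \<subseteq> {e. x e < 0}"
      using conformal_elementary[OF x] by blast
    have "vsupp z \<subseteq> vsupp x"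
    proof
      fix e assume "e \<in> vsupp z"
      then have "z e > 0 \<or> z e < 0" by (auto simp: vsupp_def)
      then have "x e > 0 \<or> x e < 0" using z(2,3) by blast
      then show "e \<in> vsupp x" by (auto simp: vsupp_def)
    qed
    then show ?thesis using z by blast
  qed
  have "(\<forall>z. elementary L z \<longrightarrow> \<not> vsupp z \<subseteq> X) \<longleftrightarrow> (\<forall>x\<in>L. vsupp x \<subseteq> X \<longrightarrow> vsupp x = {})" for X
    using ex elementaryD(1,2) by (meson subset_trans)
  then show "indeps (underlying_matroid \<O>) = free_sets E L"
    using assms by (simp add: underlying_matroid_def free_sets_def)
qed

end

section \<open>Duality and uniqueness of the cocircuits\<close>

text \<open>
  Any matroid data whose independent sets are the sets that support no nonzero vector. The matroid
  underlying an oriented matroid is of this form only propositionally, hence the parameter \<open>M\<close>.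
\<close>
locale subspace_matroid = coordinate_subspace E L for E :: "'a set" and L +
  fixes M :: "'a matroid_data"
  assumes ground: "ground M = E" and indeps: "indeps M = free_sets E L"
begin

lemma basis_free: "B \<in> bases M \<Longrightarrow> B \<subseteq> E \<and> (\<forall>x\<in>L. vsupp x \<subseteq> B \<longrightarrow> vsupp x = {})"
  by (auto simp: bases_def indeps free_sets_def)

lemma extend_to_basis:
  assumes "I \<in> free_sets E L"
  shows "\<exists>B\<in>bases M. I \<subseteq> B"
proof -
  have "free_sets E L \<subseteq> Pow E" by (auto simp: free_sets_def)
  then have "finite (free_sets E L)" using finite_E finite_subset by blast
  from finite_has_maximal2[OF this assms] show ?thesis
    by (auto simp: bases_def indeps)
qed

lemma dependent_fundamental:
  assumes "I \<in> free_sets E L" "f \<in> E" "insert f I \<notin> free_sets E L"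
  shows "\<exists>x\<in>L. vsupp x \<subseteq> insert f I \<and> x f = 1"
proof -
  obtain x where x: "x \<in> L" "vsupp x \<subseteq> insert f I" "vsupp x \<noteq> {}"
    using assms by (auto simp: free_sets_def)
  have "x f \<noteq> 0"
  proof
    assume "x f = 0"
    then have "vsupp x \<subseteq> I" using x(2) by (auto simp: vsupp_def)
    then show False using x assms(1) by (auto simp: free_sets_def)
  qed
  then show ?thesis using scale[OF x(1), of "1 / x f"] x(2)
    by (intro bexI[of _ "\<lambda>e. (1 / x f) * x e"]) (auto simp: vsupp_def)
qed

lemma fundamental_vector:
  assumes "B \<in> bases M" "f \<in> E - B"
  shows "\<exists>x\<in>L. vsupp x \<subseteq> insert f B \<and> x f = 1"
  using assms by (intro dependent_fundamental) (auto simp: bases_def indeps)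

lemma fundamental_vector_unique:
  assumes B: "B \<in> bases M" and "f \<notin> B" "x \<in> L" "vsupp x \<subseteq> insert f B" "y \<in> L" "vsupp y \<subseteq> insert f B" "x f = y f"
  shows "x = y"
proof -
  have "(\<lambda>e. 1 * x e + (-1) * y e) \<in> L" by (rule combine[OF assms(3,5)])
  moreover have "vsupp (\<lambda>e. 1 * x e + (-1) * y e) \<subseteq> B"
  proof
    fix e assume "e \<in> vsupp (\<lambda>e. 1 * x e + (-1) * y e)"
    then have "x e \<noteq> y e" by (simp add: vsupp_def)
    then have "e \<noteq> f" "e \<in> vsupp x \<union> vsupp y" using assms(7) by (auto simp: vsupp_def)
    then show "e \<in> B" using assms(4,6) by blast
  qed
  ultimately have "vsupp (\<lambda>e. 1 * x e + (-1) * y e) = {}" using basis_free[OF B] by blast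
  then have d0: "x e - y e = 0" for e by (auto simp: vsupp_def)
  show ?thesis
  proof
    fix e show "x e = y e" using d0[of e] by simp
  qed
qed

lemma fundamental_vector_elementary:
  assumes B: "B \<in> bases M" and "f \<notin> B" "x \<in> L" "vsupp x \<subseteq> insert f B" "x f \<noteq> 0"
  shows "elementary L x"
  unfolding elementary_def
proof (intro conjI ballI impI)
  show "x \<in> L" by fact
  show "vsupp x \<noteq> {}" using assms(5) by (auto simp: vsupp_def)
  fix y assume y: "y \<in> L" "vsupp y \<subset> vsupp x"
  have yf: "y f = 0"
  proof (rule ccontr)
    assume "y f \<noteq> 0"
    have "(\<lambda>e. (x f / y f) * y e) = x"
      apply (rule fundamental_vector_unique[OF B assms(2) scale[OF y(1)] _ assms(3,4)])
      using y assms(4) \<open>y f \<noteq> 0\<close> by (auto simp: vsupp_def)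
    moreover have "vsupp (\<lambda>e. (x f / y f) * y e) = vsupp y"
      using \<open>y f \<noteq> 0\<close> assms(5) by (auto simp: vsupp_def)
    ultimately show False using y(2) by simp
  qed
  then have "vsupp y \<subseteq> B" using y(2) assms(4) by (auto simp: vsupp_def)
  then show "vsupp y = {}" using basis_free[OF B] y(1) by blast
qed

text \<open>
  The vectors \<open>X f\<close> with support in \<open>insert f B\<close> and value \<open>1\<close> at \<open>f\<close> span the subspace,
  because a vector vanishing off the basis \<open>B\<close> is zero. The covector is read off from row \<open>e\<close> of
  this reduced form: value \<open>1\<close> at \<open>e\<close> and \<open>- X f e\<close> at \<open>f\<close>.
\<close>
lemma fundamental_covector:
  assumes B: "B \<in> bases M" and e: "e \<in> B"
  shows "\<exists>y\<in>orth_complement E L. y e = 1 \<and> vsupp y \<subseteq> insert e (E - B) \<and>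
     (\<forall>f\<in>E - B. \<forall>x\<in>L. vsupp x \<subseteq> insert f B \<and> x f = 1 \<longrightarrow> y f = - x e)"
proof -
  have "\<forall>f\<in>E - B. \<exists>x. x \<in> L \<and> vsupp x \<subseteq> insert f B \<and> x f = 1"
    using fundamental_vector[OF B] by blast
  then obtain X where X: "\<And>f. f \<in> E - B \<Longrightarrow> X f \<in> L \<and> vsupp (X f) \<subseteq> insert f B \<and> X f f = 1"
    by metis
  define y where "y = (\<lambda>f. if f = e then 1 else if f \<in> E - B then - X f e else 0)"
  have BE: "B \<subseteq> E" using basis_free[OF B] by blast
  have "(\<Sum>g\<in>E. x g * y g) = 0" if x: "x \<in> L" for x
  proof -
    define d where "d = (\<lambda>g. 1 * x g + (-1) * (\<Sum>f\<in>E - B. x f * X f g))"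
    have "d \<in> L" unfolding d_def
      by (rule combine[OF x sum_in]) (use finite_E X in auto)
    moreover have "vsupp d \<subseteq> B"
    proof (rule ccontr)
      assume "\<not> vsupp d \<subseteq> B"
      then obtain g where g: "d g \<noteq> 0" "g \<notin> B" by (auto simp: vsupp_def)
      have gE: "g \<in> E" using g(1) supp_subset[OF \<open>d \<in> L\<close>] by (auto simp: vsupp_def)
      have "(\<Sum>f\<in>E - B. x f * X f g) = (\<Sum>f\<in>E - B. if f = g then x g else 0)"
      proof (rule sum.cong[OF refl])
        fix f assume "f \<in> E - B"
        with X[of f] g(2) show "x f * X f g = (if f = g then x g else 0)"
          by (auto simp: vsupp_def)
      qed
      also have "\<dots> = x g" using gE g(2) finite_E by simp
      finally show False using g(1) by (simp add: d_def)
    qed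
    ultimately have "vsupp d = {}" using basis_free[OF B] by blast
    then have "d e = 0" by (auto simp: vsupp_def)
    then have xe: "x e = (\<Sum>f\<in>E - B. x f * X f e)" by (simp add: d_def)
    have "(\<Sum>g\<in>E. x g * y g) = (\<Sum>g\<in>insert e (E - B). x g * y g)"
      by (rule sum.mono_neutral_right) (use finite_E BE e in \<open>auto simp: y_def\<close>)
    also have "\<dots> = x e + (\<Sum>g\<in>E - B. x g * (- X g e))"
      using finite_E e by (subst sum.insert) (auto simp: y_def intro!: sum.cong)
    also have "\<dots> = 0" using xe by (simp add: sum_negf)
    finally show ?thesis .
  qed
  moreover have "vsupp y \<subseteq> E" using e BE by (auto simp: vsupp_def y_def split: if_splits)
  ultimately have "y \<in> orth_complement E L" by (simp add: orth_complement_def)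
  moreover have "y f = - x e" if "f \<in> E - B" "x \<in> L" "vsupp x \<subseteq> insert f B" "x f = 1" for f x
  proof -
    have "x = X f" using fundamental_vector_unique[OF B _ that(2,3), of "X f"] X[OF that(1)] that by auto
    then show ?thesis using that(1) e by (auto simp: y_def)
  qed
  ultimately show ?thesis
    by (intro bexI[of _ y]) (auto simp: y_def vsupp_def split: if_splits)
qed

lemma covector_vanishes:
  assumes B: "B \<in> bases M" and y: "y \<in> orth_complement E L" "vsupp y \<subseteq> E - B"
  shows "vsupp y = {}"
proof (rule ccontr)
  assume "vsupp y \<noteq> {}"
  then obtain f where f: "y f \<noteq> 0" by (auto simp: vsupp_def)
  then have fE: "f \<in> E - B" using y(2) by (auto simp: vsupp_def)
  then obtain x where x: "x \<in> L" "vsupp x \<subseteq> insert f B" "x f = 1" using fundamental_vector[OF B] by blast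
  have "(\<Sum>g\<in>E. x g * y g) = (\<Sum>g\<in>{f}. x g * y g)"
    by (rule sum.mono_neutral_right) (use finite_E fE x y in \<open>auto simp: vsupp_def\<close>)
  moreover have "(\<Sum>g\<in>E. x g * y g) = 0" using x(1) y(1) by (simp add: orth_complement_def)
  ultimately show False using x f by simp
qed

text \<open>
  If no covector lives on \<open>X\<close>, extend a maximal free subset \<open>I\<close> of \<open>E - X\<close> to a basis \<open>B\<close>. Were some \<open>e\<close> of \<open>X\<close> in \<open>B\<close>, its
  fundamental covector would live on \<open>X\<close>: at \<open>f\<close> outside \<open>X\<close> it is minus the
  value at \<open>e\<close> of a vector that already lives on \<open>insert f I\<close>, hence zero. So \<open>B\<close> avoids \<open>X\<close>.
\<close>
lemma dual_indeps: "indeps (dual_matroid M) = free_sets E (orth_complement E L)"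
proof (intro set_eqI iffI)
  fix X assume "X \<in> indeps (dual_matroid M)"
  then obtain B where "X \<subseteq> E" "B \<in> bases M" "X \<subseteq> E - B" by (auto simp: dual_matroid_def ground)
  then show "X \<in> free_sets E (orth_complement E L)"
    using covector_vanishes by (fastforce simp: free_sets_def)
next
  fix X assume X: "X \<in> free_sets E (orth_complement E L)"
  then have XE: "X \<subseteq> E" by (simp add: free_sets_def)
  define \<I> where "\<I> = {I \<in> free_sets E L. I \<subseteq> E - X}"
  have "\<I> \<subseteq> Pow E" by (auto simp: \<I>_def)
  then have "finite \<I>" using finite_E finite_subset by blast
  moreover have "{} \<in> \<I>" by (auto simp: \<I>_def free_sets_def)
  ultimately obtain I where I: "I \<in> \<I>" "\<And>J. J \<in> \<I> \<Longrightarrow> I \<subseteq> J \<Longrightarrow> I = J"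
    using finite_has_maximal2 by (metis (no_types, lifting))
  have If: "I \<in> free_sets E L" and IX: "I \<subseteq> E - X" using I(1) by (auto simp: \<I>_def)
  obtain B where B: "B \<in> bases M" "I \<subseteq> B" using extend_to_basis[OF If] by blast
  have "B \<inter> X = {}"
  proof (rule ccontr)
    assume "B \<inter> X \<noteq> {}"
    then obtain e where e: "e \<in> B" "e \<in> X" by blast
    obtain y where y: "y \<in> orth_complement E L" "y e = 1" "vsupp y \<subseteq> insert e (E - B)"
      "\<And>f x. f \<in> E - B \<Longrightarrow> x \<in> L \<Longrightarrow> vsupp x \<subseteq> insert f B \<Longrightarrow> x f = 1 \<Longrightarrow> y f = - x e"
      using fundamental_covector[OF B(1) e(1)] by blast
    have "vsupp y \<subseteq> X"
    proof
      fix f assume fy: "f \<in> vsupp y"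
      show "f \<in> X"
      proof (rule ccontr)
        assume fX: "f \<notin> X"
        then have fE: "f \<in> E - B" using fy y(3) e by auto
        have "insert f I \<notin> free_sets E L"
          using I(2)[of "insert f I"] fE fX IX B(2) by (auto simp: \<I>_def)
        then obtain x where x: "x \<in> L" "vsupp x \<subseteq> insert f I" "x f = 1"
          using dependent_fundamental[OF If] fE by blast
        then have "x e = 0" using e fX IX by (auto simp: vsupp_def)
        moreover have "y f = - x e" using y(4)[OF fE x(1) _ x(3)] x(2) B(2) by blast
        ultimately show False using fy by (simp add: vsupp_def)
      qed
    qed
    then have "vsupp y = {}" using X y(1) by (auto simp: free_sets_def)
    then show False using y(2) by (auto simp: vsupp_def)
  qed
  then show "X \<in> indeps (dual_matroid M)" using B(1) XE by (auto simp: dual_matroid_def ground)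
qed

lemma dual_circuits: "circuits (dual_matroid M) = vsupp ` {y. elementary (orth_complement E L) y}"
  by (rule coordinate_subspace.circuits_free_sets[OF orth_subspace])
    (simp_all add: dual_indeps, simp add: dual_matroid_def ground)

text \<open>
  The cocircuit meets some basis \<open>B\<close> only in \<open>e\<close>, and the fundamental vector of \<open>f\<close> with
  respect to \<open>B\<close> can then meet it only in \<open>e\<close> and \<open>f\<close>; orthogonality forbids it to miss \<open>e\<close>.
\<close>
lemma circuit_meeting_cocircuit:
  assumes D: "D \<in> circuits (dual_matroid M)" and ef: "e \<in> D" "f \<in> D" "e \<noteq> f"
  shows "\<exists>x. elementary L x \<and> vsupp x \<inter> D = {e, f}"
proof -
  obtain y where y: "elementary (orth_complement E L) y" "D = vsupp y"
    using D dual_circuits by auto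
  have yo: "y \<in> orth_complement E L" using y(1) by (simp add: elementary_def)
  have DE: "D \<subseteq> E" using yo y(2) by (simp add: orth_complement_def)
  have "D - {e} \<in> indeps (dual_matroid M)" using D ef by (auto simp: circuits_def)
  then obtain B where B: "B \<in> bases M" "D - {e} \<subseteq> E - B" by (auto simp: dual_matroid_def ground)
  have fB: "f \<in> E - B" using B ef DE by auto
  obtain x where x: "x \<in> L" "vsupp x \<subseteq> insert f B" "x f = 1" using fundamental_vector[OF B(1) fB] by blast
  have el: "elementary L x" using fundamental_vector_elementary[OF B(1) _ x(1,2)] fB x(3) by simp
  have "(\<Sum>g\<in>E. x g * y g) = (\<Sum>g\<in>{e, f}. x g * y g)"
  proof (rule sum.mono_neutral_right)
    show "\<forall>g\<in>E - {e, f}. x g * y g = 0"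
      using x(2) y(2) B(2) by (auto simp: vsupp_def)
  qed (use finite_E ef DE in auto)
  moreover have "(\<Sum>g\<in>E. x g * y g) = 0" using x(1) yo by (simp add: orth_complement_def)
  ultimately have "x e * y e + y f = 0" using x(3) ef(3) by simp
  moreover have "y f \<noteq> 0" using ef y(2) by (simp add: vsupp_def)
  ultimately have "x e \<noteq> 0" by auto
  then have "vsupp x \<inter> D = {e, f}" using x(2,3) B(2) ef by (auto simp: vsupp_def)
  then show ?thesis using el by blast
qed

end

lemma orthogonal_sign_vec:
  assumes "finite E" "vsupp x \<subseteq> E" "(\<Sum>e\<in>E. x e * y e) = 0"
  shows "orthogonal_signed (sign_vec x) (sign_vec y)"
proof (cases "vsupp x \<inter> vsupp y = {}")
  case False
  then obtain e where e: "x e * y e \<noteq> 0" "e \<in> E" using assms(2) by (auto simp: vsupp_def)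
  have "\<exists>g\<in>E. x g * y g > 0"
  proof (rule ccontr)
    assume "\<not> ?thesis"
    then have "\<And>g. g \<in> E \<Longrightarrow> x g * y g \<le> 0" by force
    then show False using sum_nonneg_eq_0_iff[OF assms(1), of "\<lambda>g. - (x g * y g)"] assms(3) e
      by (auto simp: sum_negf)
  qed
  moreover have "\<exists>g\<in>E. x g * y g < 0"
  proof (rule ccontr)
    assume "\<not> ?thesis"
    then have "\<And>g. g \<in> E \<Longrightarrow> x g * y g \<ge> 0" by force
    then show False using sum_nonneg_eq_0_iff[OF assms(1), of "\<lambda>g. x g * y g"] assms(3) e by auto
  qed
  ultimately obtain g h where "x g * y g > 0" "x h * y h < 0" by blast
  then have "sign_vec x g * sign_vec y g = 1" "sign_vec x h * sign_vec y h = -1"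
    by (auto simp: sign_vec_def zero_less_mult_iff mult_less_0_iff)
  then show ?thesis unfolding orthogonal_signed_def by blast
qed (simp add: orthogonal_signed_def)

context coordinate_subspace begin

lemma oriented_matroid_exists:
  "oriented_matroid \<lparr>om_ground = E, signed_circuits = sign_vec ` {x. elementary L x},
     signed_cocircuits = sign_vec ` {y. elementary (orth_complement E L) y}\<rparr>" (is "oriented_matroid ?O")
proof -
  interpret subspace_matroid E L "underlying_matroid ?O"
    by unfold_locales (use underlying_matroid_free_sets[of ?O] in auto)
  interpret o: coordinate_subspace E "orth_complement E L" by (rule orth_subspace)
  have "orthogonal_signed (sign_vec x) (sign_vec y)"
    if "elementary L x" "elementary (orth_complement E L) y" for x y
    using that supp_subset[of x]
    by (intro orthogonal_sign_vec[OF finite_E]) (auto simp: elementary_def orth_complement_def)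
  then show ?thesis
    unfolding oriented_matroid_def
    using finite_E sign_circuit_axioms o.sign_circuit_axioms dual_circuits
    by (auto simp: image_image)
qed

text \<open>
  Orthogonality with a circuit that meets the cocircuit only in \<open>e\<close> and \<open>f\<close> fixes the sign at \<open>f\<close>
  relative to the one at \<open>e\<close>. Two cocircuits with the same support therefore agree up to a global sign.
\<close>
lemma cocircuits_determined:
  assumes om: "oriented_matroid \<O>" "oriented_matroid \<O>'"
    and E: "om_ground \<O> = E" "om_ground \<O>' = E"
    and C: "signed_circuits \<O> = sign_vec ` {x. elementary L x}" "signed_circuits \<O>' = sign_vec ` {x. elementary L x}"
  shows "signed_cocircuits \<O> \<subseteq> signed_cocircuits \<O>'"
proof
  fix Y assume Y: "Y \<in> signed_cocircuits \<O>"
  have uu: "underlying_matroid \<O> = underlying_matroid \<O>'"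
    using E C by (simp add: underlying_matroid_def)
  interpret subspace_matroid E L "underlying_matroid \<O>"
    by unfold_locales (use underlying_matroid_free_sets E C in auto)
  have ax: "signed_circuit_axioms E (signed_cocircuits \<O>)" "signed_circuit_axioms E (signed_cocircuits \<O>')"
    and or: "\<And>X Y. X \<in> signed_circuits \<O> \<Longrightarrow> Y \<in> signed_cocircuits \<O> \<Longrightarrow> orthogonal_signed X Y"
      "\<And>X Y. X \<in> signed_circuits \<O>' \<Longrightarrow> Y \<in> signed_cocircuits \<O>' \<Longrightarrow> orthogonal_signed X Y"
    and su: "signed_support ` signed_cocircuits \<O> = circuits (dual_matroid (underlying_matroid \<O>))"
      "signed_support ` signed_cocircuits \<O>' = circuits (dual_matroid (underlying_matroid \<O>))"
    using om E uu by (auto simp: oriented_matroid_def)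
  have D: "signed_support Y \<in> circuits (dual_matroid (underlying_matroid \<O>))" using Y su(1) by blast
  then obtain Y' where Y': "Y' \<in> signed_cocircuits \<O>'" "signed_support Y' = signed_support Y"
    using su(2) by (metis (no_types, lifting) imageE)
  have val: "Z g \<in> {-1, 1}" if "Z \<in> {Y, Y'}" "g \<in> signed_support Y" for Z g
  proof -
    have "Z g \<in> {-1, 0, 1}"
      using ax that(1) Y Y'(1) by (auto simp: signed_circuit_axioms_def signed_subset_def)
    then show ?thesis using that Y'(2) by (auto simp: signed_support_def)
  qed
  obtain e where e: "e \<in> signed_support Y"
    using ax(1) Y unfolding signed_circuit_axioms_def by blast
  have rel: "Y e * Y' e = Y f * Y' f" if f: "f \<in> signed_support Y" for f
  proof (cases "e = f")
    case False
    obtain x where x: "elementary L x" "vsupp x \<inter> signed_support Y = {e, f}"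
      using circuit_meeting_cocircuit[OF D e f False] by blast
    let ?X = "sign_vec x"
    have opp: "?X e * Z e = - (?X f * Z f)" if Z: "Z \<in> {Y, Y'}" for Z
    proof -
      have sZ: "signed_support Z = signed_support Y" using Z Y'(2) by auto
      have "orthogonal_signed ?X Z"
        using Z or(1)[of ?X Y] or(2)[of ?X Y'] C x(1) Y Y'(1) by auto
      moreover have "signed_support ?X \<inter> signed_support Z \<noteq> {}" using x(2) sZ by simp
      ultimately obtain a b where ab: "?X a * Z a = 1" "?X b * Z b = -1"
        by (auto simp: orthogonal_signed_def)
      have "a \<in> signed_support ?X \<inter> signed_support Z" "b \<in> signed_support ?X \<inter> signed_support Z"
        using ab by (auto simp: signed_support_def simp del: signed_support_sign_vec)
      then have "a \<in> {e, f}" "b \<in> {e, f}" using x(2) sZ by auto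
      then show ?thesis using ab by auto
    qed
    have "?X e \<in> {-1, 1}" "?X f \<in> {-1, 1}"
      using x(2) by (auto simp: sign_vec_def vsupp_def)
    then show ?thesis using opp[of Y] opp[of Y'] val[of Y e] val[of Y' e] val[of Y f] val[of Y' f] e f by auto
  qed simp
  have "Y = Y' \<or> Y = - Y'"
  proof (cases "Y e = Y' e")
    case True
    have "Y g = Y' g" for g
    proof (cases "g \<in> signed_support Y")
      case g: True
      show ?thesis using rel[OF g] val[of Y g] val[of Y' g] val[of Y e] val[of Y' e] e g True by auto
    qed (use Y'(2) in \<open>auto simp: signed_support_def\<close>)
    then show ?thesis by blast
  next
    case False
    have "Y g = - Y' g" for g
    proof (cases "g \<in> signed_support Y")
      case g: True
      show ?thesis using rel[OF g] val[of Y g] val[of Y' g] val[of Y e] val[of Y' e] e g False by auto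
    qed (use Y'(2) in \<open>auto simp: signed_support_def\<close>)
    then show ?thesis by (auto simp: fun_eq_iff)
  qed
  then show "Y \<in> signed_cocircuits \<O>'"
    using Y'(1) ax(2) by (auto simp: signed_circuit_axioms_def)
qed

theorem ex1_oriented_matroid:
  "\<exists>!\<O>. oriented_matroid \<O> \<and> om_ground \<O> = E \<and> signed_circuits \<O> = sign_vec ` {x. elementary L x}"
proof (rule ex_ex1I)
  show "\<exists>\<O>. oriented_matroid \<O> \<and> om_ground \<O> = E \<and> signed_circuits \<O> = sign_vec ` {x. elementary L x}"
    by (rule exI, intro conjI, rule oriented_matroid_exists) simp_all
  fix \<O> \<O>'
  assume "oriented_matroid \<O> \<and> om_ground \<O> = E \<and> signed_circuits \<O> = sign_vec ` {x. elementary L x}"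
    "oriented_matroid \<O>' \<and> om_ground \<O>' = E \<and> signed_circuits \<O>' = sign_vec ` {x. elementary L x}"
  then show "\<O> = \<O>'"
    using cocircuits_determined[of \<O> \<O>'] cocircuits_determined[of \<O>' \<O>]
    by (intro oriented_matroid_data.equality) auto
qed

end

section \<open>Leibniz determinants indexed by a finite set\<close>

text \<open>
  A determinant indexed by an arbitrary finite set rather than by an initial segment or a finite type:
  the permutations of the vertex set itself are what corresponds to routings. The first argument of the
  matrix is the column, the second one the row.
\<close>
definition leibniz_det :: "'a set \<Rightarrow> ('a \<Rightarrow> 'a \<Rightarrow> real) \<Rightarrow> real" where
  "leibniz_det V A = (\<Sum>p | p permutes V. of_int (sign p) * (\<Prod>v\<in>V. A v (p v)))"

abbreviation unit_vec :: "'a \<Rightarrow> 'a \<Rightarrow> real" where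
  "unit_vec u \<equiv> \<lambda>r. if r = u then 1 else 0"

lemma leibniz_det_cong:
  assumes "\<And>v u. v \<in> V \<Longrightarrow> u \<in> V \<Longrightarrow> A v u = B v u"
  shows "leibniz_det V A = leibniz_det V B"
  unfolding leibniz_det_def
  by (intro sum.cong arg_cong2[where f = "(*)"] prod.cong refl assms) (auto simp: permutes_in_image)

lemma leibniz_det_transpose:
  assumes "finite V"
  shows "leibniz_det V (\<lambda>v u. A u v) = leibniz_det V A"
proof -
  have "leibniz_det V (\<lambda>v u. A u v) = (\<Sum>p | p permutes V. of_int (sign (inv p)) * (\<Prod>v\<in>V. A (inv p v) v))"
    unfolding leibniz_det_def
    by (rule sum.reindex_bij_witness[of _ inv inv])
      (auto simp: permutes_inv permutes_inv_inv)
  also have "\<dots> = leibniz_det V A"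
    unfolding leibniz_det_def
  proof (rule sum.cong[OF refl], clarify)
    fix p assume p: "p permutes V"
    have "sign (inv p) = sign p" using assms p permutation_permutes sign_inverse by blast
    moreover have "(\<Prod>v\<in>V. A (inv p v) v) = (\<Prod>v\<in>V. A v (p v))"
      by (rule prod.reindex_bij_witness[of _ p "inv p"])
        (use p in \<open>auto simp: permutes_inverses permutes_in_image permutes_inv\<close>)
    ultimately show "of_int (sign (inv p)) * (\<Prod>v\<in>V. A (inv p v) v) = of_int (sign p) * (\<Prod>v\<in>V. A v (p v))"
      by simp
  qed
  finally show ?thesis .
qed

lemma leibniz_det_swap:
  assumes "finite V" "v \<in> V" "w \<in> V" "v \<noteq> w"
  shows "leibniz_det V (\<lambda>x. A (transpose v w x)) = - leibniz_det V A"
proof -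
  let ?t = "transpose v w"
  have t: "?t permutes V" using assms by (simp add: permutes_swap_id)
  have "leibniz_det V (\<lambda>x. A (?t x)) = (\<Sum>p | p permutes V. of_int (sign (p \<circ> ?t)) * (\<Prod>x\<in>V. A (?t x) ((p \<circ> ?t) x)))"
    unfolding leibniz_det_def
    by (rule sum.reindex_bij_witness[of _ "\<lambda>p. p \<circ> ?t" "\<lambda>p. p \<circ> ?t"])
      (auto simp: comp_assoc permutes_compose[OF t])
  also have "\<dots> = (\<Sum>p | p permutes V. - (of_int (sign p) * (\<Prod>x\<in>V. A x (p x))))"
  proof (rule sum.cong[OF refl], clarify)
    fix p assume p: "p permutes V"
    have "permutation p" using p assms(1) permutation_permutes by blast
    then have "sign (p \<circ> ?t) = - sign p"
      by (simp add: sign_compose permutation_swap_id sign_swap_id assms)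
    moreover have "(\<Prod>x\<in>V. A (?t x) ((p \<circ> ?t) x)) = (\<Prod>x\<in>V. A x (p x))"
      by (rule prod.reindex_bij_witness[of _ ?t ?t]) (use t in \<open>auto simp: permutes_in_image\<close>)
    ultimately show "of_int (sign (p \<circ> ?t)) * (\<Prod>x\<in>V. A (?t x) ((p \<circ> ?t) x)) =
        - (of_int (sign p) * (\<Prod>x\<in>V. A x (p x)))" by simp
  qed
  also have "\<dots> = - leibniz_det V A" by (simp add: leibniz_det_def sum_negf)
  finally show ?thesis .
qed

lemma leibniz_det_equal_columns:
  assumes "finite V" "v \<in> V" "w \<in> V" "v \<noteq> w" "A v = A w"
  shows "leibniz_det V A = 0"
proof -
  have "(\<lambda>x. A (transpose v w x)) = A"
    using assms(5) by (auto simp: fun_eq_iff transpose_def)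
  then show ?thesis using leibniz_det_swap[OF assms(1-4), of A] by simp
qed

lemma leibniz_det_column_sum:
  assumes "finite V" "v \<in> V"
  shows "leibniz_det V (A(v := \<lambda>u. \<Sum>i\<in>I. c i * a i u)) = (\<Sum>i\<in>I. c i * leibniz_det V (A(v := a i)))"
proof -
  have split: "(\<Prod>x\<in>V. (A(v := b)) x (p x)) = b (p v) * (\<Prod>x\<in>V - {v}. A x (p x))" for p b
    using assms by (subst prod.remove[of V v]) (auto intro!: prod.cong)
  show ?thesis
    unfolding leibniz_det_def split
    by (simp add: sum_distrib_left sum_distrib_right sum.swap[of _ I] mult_ac)
qed

lemma leibniz_det_column_combine:
  assumes "finite V" "v \<in> V"
  shows "leibniz_det V (A(v := \<lambda>u. a * f u + b * g u))
    = a * leibniz_det V (A(v := f)) + b * leibniz_det V (A(v := g))"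
  using leibniz_det_column_sum[OF assms, of A "\<lambda>i. if i then a else b" "\<lambda>i. if i then f else g" UNIV]
  by (simp add: UNIV_bool algebra_simps)

text \<open>
  A nonzero row vector that kills all columns makes the matrix singular. In the
  transposed matrix the combination of columns with coefficients \<open>z\<close> vanishes, and all its summands but
  one repeat a column.
\<close>
lemma leibniz_det_annihilated:
  assumes "finite V" "u \<in> V" "z u \<noteq> 0"
    and "\<And>v. v \<in> V \<Longrightarrow> (\<Sum>w\<in>V. z w * A v w) = 0"
  shows "leibniz_det V A = 0"
proof -
  define B where "B = (\<lambda>v u. A u v)"
  have "0 = leibniz_det V (B(u := \<lambda>_. 0))"
    unfolding leibniz_det_def using assms(1,2)
    by (intro sum.neutral[symmetric] ballI mult_eq_0_iff[THEN iffD2] disjI2 prod_zero) auto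
  also have "\<dots> = leibniz_det V (B(u := \<lambda>v. \<Sum>w\<in>V. z w * B w v))"
    by (rule leibniz_det_cong) (use assms(4) in \<open>auto simp: B_def\<close>)
  also have "\<dots> = (\<Sum>w\<in>V. z w * leibniz_det V (B(u := B w)))"
    by (rule leibniz_det_column_sum[OF assms(1,2)])
  also have "\<dots> = (\<Sum>w\<in>V. if w = u then z u * leibniz_det V B else 0)"
  proof (rule sum.cong[OF refl])
    fix w assume "w \<in> V"
    then show "z w * leibniz_det V (B(u := B w)) = (if w = u then z u * leibniz_det V B else 0)"
      using leibniz_det_equal_columns[OF assms(1,2), of w "B(u := B w)"] by auto
  qed
  also have "\<dots> = z u * leibniz_det V B" using assms(1,2) by simp
  finally show ?thesis using assms(3) leibniz_det_transpose[OF assms(1), of A] by (simp add: B_def)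
qed

lemma leibniz_det_cramer:
  assumes "finite V" "c \<in> V" "v \<in> V"
  shows "(\<Sum>u\<in>V. leibniz_det V (A(c := unit_vec u)) * A v u) = (if v = c then leibniz_det V A else 0)"
proof -
  have "(\<Sum>u\<in>V. leibniz_det V (A(c := unit_vec u)) * A v u)
      = leibniz_det V (A(c := \<lambda>r. \<Sum>u\<in>V. A v u * unit_vec u r))"
    by (subst leibniz_det_column_sum[OF assms(1,2)]) (simp add: mult.commute)
  also have "\<dots> = leibniz_det V (A(c := A v))"
    by (rule leibniz_det_cong) (use assms(1) in \<open>auto simp: if_distrib cong: if_cong\<close>)
  also have "\<dots> = (if v = c then leibniz_det V A else 0)"
    using leibniz_det_equal_columns[OF assms(1,2,3), of "A(c := A v)"] by auto
  finally show ?thesis .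
qed

text \<open>
  The combination \<open>x\<^sub>k A\<^sub>j - x\<^sub>j A\<^sub>k\<close> of columns, with \<open>x\<^sub>j\<close> and \<open>x\<^sub>k\<close> the values of \<open>z\<close> on them, is
  annihilated by \<open>z\<close>. With it in place of column \<open>j\<close> and \<open>t\<close> in place of column \<open>k\<close>, all columns
  are annihilated and the determinant vanishes; expanding it and swapping two columns gives the relation.
\<close>
lemma leibniz_det_exchange:
  assumes V: "finite V" "j \<in> V" "k \<in> V" "j \<noteq> k" and u: "u \<in> V" "z u \<noteq> 0"
    and null: "\<And>v. v \<in> V - {j, k} \<Longrightarrow> (\<Sum>w\<in>V. z w * A v w) = 0"
    and t: "(\<Sum>w\<in>V. z w * t w) = 0"
  shows "(\<Sum>w\<in>V. z w * A k w) * leibniz_det V (A(k := t)) = - (\<Sum>w\<in>V. z w * A j w) * leibniz_det V (A(j := t))"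
proof -
  define xj where "xj = (\<Sum>w\<in>V. z w * A j w)"
  define xk where "xk = (\<Sum>w\<in>V. z w * A k w)"
  let ?c = "\<lambda>r. xk * A j r + (- xj) * A k r"
  have "(\<Sum>w\<in>V. z w * ?c w) = xk * (\<Sum>w\<in>V. z w * A j w) - xj * (\<Sum>w\<in>V. z w * A k w)"
    by (simp add: sum_subtractf sum_distrib_left algebra_simps)
  also have "\<dots> = 0" by (simp flip: xj_def xk_def)
  finally have c0: "(\<Sum>w\<in>V. z w * ?c w) = 0" by simp
  have "leibniz_det V ((A(k := t))(j := ?c)) = 0"
  proof (rule leibniz_det_annihilated[where z = z, OF V(1) u])
    fix v assume v: "v \<in> V"
    consider "v = j" | "v = k" | "v \<in> V - {j, k}" using v by auto
    then show "(\<Sum>w\<in>V. z w * ((A(k := t))(j := ?c)) v w) = 0"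
      by cases (use c0 t null V in auto)
  qed
  then have "xk * leibniz_det V ((A(k := t))(j := A j)) - xj * leibniz_det V ((A(k := t))(j := A k)) = 0"
    using leibniz_det_column_combine[OF V(1,2), of "A(k := t)" xk "A j" "- xj" "A k"] by simp
  moreover have "(A(k := t))(j := A j) = A(k := t)" using V by (auto simp: fun_eq_iff)
  moreover have "(A(k := t))(j := A k) = (\<lambda>x. (A(j := t)) (transpose j k x))"
    using V(4) by (auto simp: fun_eq_iff transpose_def)
  ultimately have "xk * leibniz_det V (A(k := t)) = - xj * leibniz_det V (A(j := t))"
    using leibniz_det_swap[OF V, of "A(j := t)"] by simp
  then show ?thesis by (simp add: xj_def xk_def)
qed

section \<open>Signs of permutations and inversions\<close>

definition inversions :: "'a::linorder set \<Rightarrow> ('a \<Rightarrow> 'b::linorder) \<Rightarrow> ('a \<times> 'a) set" where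
  "inversions X f = {(x, y). x \<in> X \<and> y \<in> X \<and> x < y \<and> f y < f x}"

lemma inversions_prod:
  assumes "finite X"
  shows "(-1::int) ^ card (inversions X f)
    = (\<Prod>(x, y)\<in>{(x, y). x \<in> X \<and> y \<in> X \<and> x < y}. if f y < f x then -1 else 1)"
proof -
  let ?P = "{(x, y). x \<in> X \<and> y \<in> X \<and> x < y}"
  have fin: "finite ?P" by (rule finite_subset[of _ "X \<times> X"]) (use assms in auto)
  have "inversions X f = {z \<in> ?P. f (snd z) < f (fst z)}" by (auto simp: inversions_def)
  then have "(-1::int) ^ card (inversions X f) = (\<Prod>z\<in>{z \<in> ?P. f (snd z) < f (fst z)}. -1)" by simp
  also have "\<dots> = (\<Prod>z\<in>?P. if f (snd z) < f (fst z) then -1 else 1)"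
    using fin by (rule prod.inter_filter)
  also have "\<dots> = (\<Prod>(x, y)\<in>?P. if f y < f x then -1 else 1)" by (rule prod.cong) auto
  finally show ?thesis .
qed

text \<open>
  Whether \<open>f\<close> reverses the order is a property of unordered pairs, and \<open>p\<close> permutes the unordered
  pairs. Each unordered pair is represented by its increasing listing.
\<close>
lemma inversions_compose:
  assumes fin: "finite X" and p: "p permutes X" and f: "inj_on f X"
  shows "(-1::int) ^ card (inversions X (f \<circ> p)) = (-1) ^ card (inversions X f) * (-1) ^ card (inversions X p)"
proof -
  let ?P = "{(x, y). x \<in> X \<and> y \<in> X \<and> x < y}"
  let ?g = "\<lambda>(x, y). (min (p x) (p y), max (p x) (p y))"
  let ?q = "\<lambda>(x, y). if f y < f x then -1 else (1::int)"
  have finP: "finite ?P" by (rule finite_subset[of _ "X \<times> X"]) (use fin in auto)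
  have pX: "p x \<in> X" if "x \<in> X" for x using p that by (simp add: permutes_in_image)
  have pinj: "p x = p y \<longleftrightarrow> x = y" for x y using p by (metis permutes_inj injD)
  have sub: "?g ` ?P \<subseteq> ?P"
  proof (rule image_subsetI, clarify)
    fix x y assume "x \<in> X" "y \<in> X" "x < y"
    then show "min (p x) (p y) \<in> X \<and> max (p x) (p y) \<in> X \<and> min (p x) (p y) < max (p x) (p y)"
      using pX pinj[of x y] by (auto simp: min_def max_def)
  qed
  have inj: "inj_on ?g ?P"
  proof (rule inj_onI, clarify)
    fix x y x' y' assume H: "x < y" "x' < y'" "min (p x) (p y) = min (p x') (p y')" "max (p x) (p y) = max (p x') (p y')"
    then have "(p x = p x' \<and> p y = p y') \<or> (p x = p y' \<and> p y = p x')"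
      by (auto simp: min_def max_def split: if_splits)
    then show "x = x' \<and> y = y'" using H(1,2) by (auto simp: pinj)
  qed
  have bij: "?g ` ?P = ?P" using endo_inj_surj[OF finP sub inj] .
  have "(\<Prod>z\<in>?P. ?q z) = (\<Prod>z\<in>?g ` ?P. ?q z)" by (simp only: bij)
  also have "\<dots> = (\<Prod>z\<in>?P. ?q (?g z))" by (rule prod.reindex_cong[OF inj refl refl])
  finally have 1: "(\<Prod>z\<in>?P. ?q z) = (\<Prod>z\<in>?P. ?q (?g z))" .
  have "(\<Prod>z\<in>?P. case z of (x, y) \<Rightarrow> if (f \<circ> p) y < (f \<circ> p) x then -1 else (1::int))
      = (\<Prod>z\<in>?P. ?q (?g z) * (case z of (x, y) \<Rightarrow> if p y < p x then -1 else 1))"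
  proof (rule prod.cong[OF refl])
    fix z assume "z \<in> ?P"
    then obtain x y where z: "z = (x, y)" and xy: "x \<in> X" "y \<in> X" "x < y" by auto
    have "f (p x) \<noteq> f (p y)" using xy pX f pinj[of x y] by (auto simp: inj_on_def)
    moreover have "p x \<noteq> p y" using xy pinj[of x y] by auto
    ultimately show "(case z of (x, y) \<Rightarrow> if (f \<circ> p) y < (f \<circ> p) x then -1 else (1::int))
        = ?q (?g z) * (case z of (x, y) \<Rightarrow> if p y < p x then -1 else 1)"
      unfolding z by (auto simp: min_def max_def)
  qed
  also have "\<dots> = (\<Prod>z\<in>?P. ?q z) * (\<Prod>z\<in>?P. case z of (x, y) \<Rightarrow> if p y < p x then -1 else 1)"
    by (simp only: prod.distrib 1)
  finally show ?thesis unfolding inversions_prod[OF fin] .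
qed

text \<open>
  For \<open>a < b\<close> the inversions are \<open>(a, b)\<close> and, for each \<open>k\<close> strictly between,
  the two pairs \<open>(a, k)\<close> and \<open>(k, b)\<close>.
\<close>
lemma inversions_transpose:
  assumes fin: "finite X" and ab: "a \<in> X" "b \<in> X" "a \<noteq> b"
  shows "(-1::int) ^ card (inversions X (transpose a b)) = -1"
  using ab
proof (induction a b rule: linorder_wlog)
  case (le a b)
  then have ab: "a < b" "a \<in> X" "b \<in> X" by auto
  define K where "K = {k \<in> X. a < k \<and> k < b}"
  have finK: "finite K" using fin by (simp add: K_def)
  have "inversions X (transpose a b) = insert (a, b) ((\<lambda>k. (a, k)) ` K \<union> (\<lambda>k. (k, b)) ` K)"
    using ab by (auto simp: inversions_def K_def transpose_def split: if_splits)
  also have "card \<dots> = Suc (card ((\<lambda>k. (a, k)) ` K \<union> (\<lambda>k. (k, b)) ` K))"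
    using finK by (subst card_insert_disjoint) (auto simp: K_def)
  also have "\<dots> = Suc (card K + card K)"
    using finK by (subst card_Un_disjoint) (auto simp: K_def card_image inj_on_def)
  finally show ?case by (simp flip: mult_2)
next
  case (sym a b)
  then show ?case by (metis transpose_commute)
qed

lemma sign_eq_inversions:
  assumes "finite X" "p permutes X"
  shows "sign p = (-1) ^ card (inversions X p)"
  using assms(2,1)
proof (induction rule: permutes_induct)
  case id
  have "inversions X id = {}" by (auto simp: inversions_def)
  then show ?case by (simp only: sign_id card.empty power_0)
next
  case (swap a b p)
  have t: "transpose a b permutes X" using swap by (simp add: permutes_swap_id)
  have "permutation p" using swap assms(1) permutation_permutes by blast
  then have "sign (transpose a b \<circ> p) = - sign p"
    using swap by (simp add: sign_compose permutation_swap_id sign_swap_id)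
  moreover have "(-1::int) ^ card (inversions X (transpose a b \<circ> p)) = - ((-1) ^ card (inversions X p))"
    using inversions_compose[OF assms(1) swap(4), of "transpose a b"] inversions_transpose[OF assms(1) swap(1,2,3)]
    by simp
  ultimately show ?case by (metis swap.IH)
qed

lemma nth_elem_strict_mono:
  assumes "finite X" "1 \<le> i" "i < j" "j \<le> card X"
  shows "nth_elem X i < nth_elem X j"
  unfolding nth_elem_def
proof (rule sorted_wrt_nth_less)
  show "sorted_wrt (<) (sorted_list_of_set X)" by (rule strict_sorted_list_of_set)
qed (use assms in auto)

lemma nth_elem_less_iff:
  assumes "finite X" "i \<in> {1..card X}" "j \<in> {1..card X}"
  shows "nth_elem X i < nth_elem X j \<longleftrightarrow> i < j"
  using assms nth_elem_strict_mono[of X i j] nth_elem_strict_mono[of X j i]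
  by (cases i j rule: linorder_cases) auto

lemma nth_elem_eq_iff:
  assumes "finite X" "i \<in> {1..card X}" "j \<in> {1..card X}"
  shows "nth_elem X i = nth_elem X j \<longleftrightarrow> i = j"
  using nth_elem_less_iff[OF assms] nth_elem_less_iff[OF assms(1,3,2)] by (metis linorder_neq_iff)

lemma bij_betw_nth_elem:
  assumes "finite X"
  shows "bij_betw (nth_elem X) {1..card X} X"
proof -
  have "inj_on (nth_elem X) {1..card X}"
    using nth_elem_eq_iff[OF assms] by (auto intro: inj_onI)
  moreover have "nth_elem X ` {1..card X} \<subseteq> X"
  proof (rule image_subsetI)
    fix i assume "i \<in> {1..card X}"
    then have "i - 1 < length (sorted_list_of_set X)" by auto
    then have "nth_elem X i \<in> set (sorted_list_of_set X)" unfolding nth_elem_def by (rule nth_mem)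
    then show "nth_elem X i \<in> X" using assms by simp
  qed
  ultimately show ?thesis
    using assms by (simp add: bij_betw_def card_image card_subset_eq)
qed

lemma nth_elem_in: "finite X \<Longrightarrow> i \<in> {1..card X} \<Longrightarrow> nth_elem X i \<in> X"
  using bij_betw_nth_elem by (metis bij_betwE)

lemma elem_index_nth_elem:
  assumes "finite X" "i \<in> {1..card X}"
  shows "elem_index X (nth_elem X i) = i"
  unfolding elem_index_def
proof (rule the_equality)
  fix j assume "j \<in> {1..card X} \<and> nth_elem X j = nth_elem X i"
  then show "j = i" using nth_elem_eq_iff[OF assms(1) _ assms(2)] by blast
qed (use assms(2) in simp)

lemma obtain_index:
  assumes "finite X" "x \<in> X"
  obtains i where "i \<in> {1..card X}" "nth_elem X i = x"
  using bij_betw_nth_elem[OF assms(1)] assms(2) by (metis bij_betw_def imageE)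

text \<open>
  The map \<open>routing_map\<close> goes between positions in the ordered sets \<open>X\<close> and \<open>T\<close>. Following it by the inverse of
  an increasing bijection \<open>\<tau>\<close> from \<open>X\<close> to the set of ends does not affect inversions and
  turns it into a permutation \<open>\<chi>\<close> of \<open>X\<close>, whose sign is understood.
\<close>
lemma map_sign_eq_sign:
  assumes fin: "finite X" "finite T" and \<chi>: "\<chi> permutes X" and \<tau>: "strict_mono_on X \<tau>"
    and inj: "inj_on hd R" and hd: "hd ` R = X" and last: "last ` R \<subseteq> T"
    and ends: "\<And>p. p \<in> R \<Longrightarrow> \<tau> (\<chi> (hd p)) = last p"
  shows "map_sign (card X) (routing_map X T R) = sign \<chi>"
proof -
  let ?\<phi> = "routing_map X T R" and ?n = "card X" and ?e = "nth_elem X"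
  have \<phi>: "?\<phi> i \<in> {1..card T} \<and> nth_elem T (?\<phi> i) = \<tau> (\<chi> (?e i))" if i: "i \<in> {1..?n}" for i
  proof -
    have "?e i \<in> X" using nth_elem_in[OF fin(1) i] .
    then obtain p where p: "p \<in> R" "hd p = ?e i" using hd by (metis imageE)
    then obtain j where j: "j \<in> {1..card T}" "nth_elem T j = last p"
      using last fin(2) obtain_index by blast
    have "?\<phi> i = j"
      unfolding routing_map_def
    proof (rule the_equality)
      show "j \<in> {1..card T} \<and> (\<exists>p\<in>R. hd p = ?e i \<and> last p = nth_elem T j)" using p j by force
      fix k assume k: "k \<in> {1..card T} \<and> (\<exists>p\<in>R. hd p = ?e i \<and> last p = nth_elem T k)"
      then obtain q where q: "q \<in> R" "hd q = ?e i" "last q = nth_elem T k" by blast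
      have "q = p" using inj_onD[OF inj] q p by simp
      then have "nth_elem T k = nth_elem T j" using q j by simp
      then show "k = j" using nth_elem_eq_iff[OF fin(2)] k j(1) by blast
    qed
    then show ?thesis using j p ends by metis
  qed
  let ?S = "{(i, j). i \<in> {1..?n} \<and> j \<in> {1..?n} \<and> i < j \<and> ?\<phi> i > ?\<phi> j}"
  have \<phi>less: "?\<phi> j < ?\<phi> i \<longleftrightarrow> \<chi> (?e j) < \<chi> (?e i)" if "i \<in> {1..?n}" "j \<in> {1..?n}" for i j
  proof -
    have "\<chi> (?e i) \<in> X" "\<chi> (?e j) \<in> X" using that nth_elem_in[OF fin(1)] \<chi> by (auto simp: permutes_in_image)
    then have "\<tau> (\<chi> (?e j)) < \<tau> (\<chi> (?e i)) \<longleftrightarrow> \<chi> (?e j) < \<chi> (?e i)"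
      using \<tau> by (simp add: strict_mono_on_less)
    then show ?thesis using \<phi>[OF that(1)] \<phi>[OF that(2)] nth_elem_less_iff[OF fin(2)] by metis
  qed
  have inje: "inj_on ?e {1..?n}" using bij_betw_nth_elem[OF fin(1)] by (simp add: bij_betw_def)
  have "inversions X \<chi> = map_prod ?e ?e ` ?S"
  proof (intro set_eqI iffI)
    fix z assume "z \<in> inversions X \<chi>"
    then obtain x y where z: "z = (x, y)" "x \<in> X" "y \<in> X" "x < y" "\<chi> y < \<chi> x" by (auto simp: inversions_def)
    obtain i where i: "i \<in> {1..?n}" "?e i = x" using obtain_index[OF fin(1) z(2)] .
    obtain j where j: "j \<in> {1..?n}" "?e j = y" using obtain_index[OF fin(1) z(3)] .
    have "i < j" using nth_elem_less_iff[OF fin(1) i(1) j(1)] i j z by simp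
    moreover have "?\<phi> j < ?\<phi> i" using \<phi>less[OF i(1) j(1)] i j z by simp
    ultimately have "(i, j) \<in> ?S" using i j by simp
    moreover have "z = map_prod ?e ?e (i, j)" using z(1) i(2) j(2) by simp
    ultimately show "z \<in> map_prod ?e ?e ` ?S" by (rule rev_image_eqI)
  next
    fix z assume "z \<in> map_prod ?e ?e ` ?S"
    then obtain i j where z: "z = (?e i, ?e j)" "i \<in> {1..?n}" "j \<in> {1..?n}" "i < j" "?\<phi> j < ?\<phi> i" by auto
    then show "z \<in> inversions X \<chi>"
      using \<phi>less[OF z(2,3)] nth_elem_less_iff[OF fin(1) z(2,3)] nth_elem_in[OF fin(1)]
      by (auto simp: inversions_def)
  qed
  moreover have "inj_on (map_prod ?e ?e) ?S"
    by (rule inj_on_subset[OF map_prod_inj_on[OF inje inje]]) auto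
  ultimately have "card (inversions X \<chi>) = card ?S" by (simp add: card_image)
  then show ?thesis using sign_eq_inversions[OF fin(1) \<chi>] by (simp add: map_sign_def)
qed

text \<open>
  Both sets are listed in increasing order, and equal positions correspond.
\<close>
lemma ex_strict_mono_bij:
  fixes X :: "'a::linorder set" and S :: "'b::linorder set"
  assumes "finite X" "finite S" "card X = card S"
  shows "\<exists>\<tau>. bij_betw \<tau> X S \<and> strict_mono_on X \<tau>"
proof -
  define \<tau> where "\<tau> = nth_elem S \<circ> inv_into {1..card X} (nth_elem X)"
  have bX: "bij_betw (inv_into {1..card X} (nth_elem X)) X {1..card X}"
    by (rule bij_betw_inv_into[OF bij_betw_nth_elem[OF assms(1)]])
  have "bij_betw \<tau> X S"
    unfolding \<tau>_def using bX bij_betw_nth_elem[OF assms(2)] assms(3) by (metis bij_betw_trans)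
  moreover have "strict_mono_on X \<tau>"
  proof (rule strict_mono_onI)
    fix a b assume ab: "a \<in> X" "b \<in> X" "a < b"
    obtain i where i: "i \<in> {1..card X}" "nth_elem X i = a" using obtain_index[OF assms(1) ab(1)] .
    obtain j where j: "j \<in> {1..card X}" "nth_elem X j = b" using obtain_index[OF assms(1) ab(2)] .
    have inj: "inj_on (nth_elem X) {1..card X}" using bij_betw_nth_elem[OF assms(1)] by (simp add: bij_betw_def)
    have "i < j" using nth_elem_less_iff[OF assms(1) i(1) j(1)] i j ab by simp
    then have "nth_elem S i < nth_elem S j" using nth_elem_less_iff[OF assms(2), of i j] i j assms(3) by simp
    moreover have "inv_into {1..card X} (nth_elem X) a = i" "inv_into {1..card X} (nth_elem X) b = j"
      using inv_into_f_f[OF inj i(1)] inv_into_f_f[OF inj j(1)] i(2) j(2) by simp_all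
    ultimately show "\<tau> a < \<tau> b" by (simp add: \<tau>_def)
  qed
  ultimately show ?thesis by blast
qed

section \<open>Paths and the cyclic permutations along them\<close>

lemma vwalk_arcs_in_set:
  "(u, v) \<in> set (vwalk_arcs p) \<Longrightarrow> u \<in> set p \<and> v \<in> set p"
  by (induction p rule: vwalk_arcs.induct) auto

lemma vwalk_arc_into:
  "v \<in> set p \<Longrightarrow> v \<noteq> hd p \<Longrightarrow> \<exists>u. (u, v) \<in> set (vwalk_arcs p)"
  by (induction p rule: vwalk_arcs.induct) auto

lemma vwalk_arc_out_of:
  "u \<in> set p \<Longrightarrow> u \<noteq> last p \<Longrightarrow> \<exists>v. (u, v) \<in> set (vwalk_arcs p)"
  by (induction p rule: vwalk_arcs.induct) (auto split: if_splits)

lemma vwalk_arc_not_hd: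
  "distinct p \<Longrightarrow> (u, v) \<in> set (vwalk_arcs p) \<Longrightarrow> v \<noteq> hd p \<and> u \<noteq> v"
  by (induction p rule: vwalk_arcs.induct) (auto dest: vwalk_arcs_in_set)

lemma vwalk_arc_not_last:
  "distinct p \<Longrightarrow> (u, v) \<in> set (vwalk_arcs p) \<Longrightarrow> u \<noteq> last p"
  by (induction p rule: vwalk_arcs.induct) (auto dest: vwalk_arcs_in_set split: if_splits)

lemma vwalk_arc_target_unique:
  "distinct p \<Longrightarrow> (u, v) \<in> set (vwalk_arcs p) \<Longrightarrow> (u, v') \<in> set (vwalk_arcs p) \<Longrightarrow> v = v'"
  by (induction p rule: vwalk_arcs.induct) (auto dest: vwalk_arcs_in_set)

lemma hd_reaches:
  "set (vwalk_arcs p) \<subseteq> A \<Longrightarrow> z \<in> set p \<Longrightarrow> (hd p, z) \<in> A\<^sup>*"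
  by (induction p rule: vwalk_arcs.induct) (auto intro: converse_rtrancl_into_rtrancl)

lemma acyclic_walk_distinct:
  "acyclic A \<Longrightarrow> set (vwalk_arcs p) \<subseteq> A \<Longrightarrow> distinct p"
proof (induction p rule: vwalk_arcs.induct)
  case (3 x y xs)
  have "x \<notin> set (y # xs)"
  proof
    assume "x \<in> set (y # xs)"
    then have "(y, x) \<in> A\<^sup>*" using hd_reaches[of "y # xs" A x] 3(3) by simp
    moreover have "(x, y) \<in> A" using 3(3) by simp
    ultimately have "(x, x) \<in> A\<^sup>+" by (rule rtrancl_into_trancl2[rotated])
    then show False using 3(2) by (simp add: acyclic_def)
  qed
  then show ?case using 3 by simp
qed simp_all

lemma walk_set_subset: "set p \<subseteq> insert (hd p) (snd ` set (vwalk_arcs p))"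
  by (induction p rule: vwalk_arcs.induct) auto

text \<open>
  The cycle runs backwards along the path and closes up from the first to the last vertex, as
  the permutations in the Leibniz expansion do. Its length is the number of arcs plus one,
  whence the sign.
\<close>
lemma path_cycle:
  assumes "distinct p" "p \<noteq> []"
  shows "\<exists>\<kappa>. \<kappa> permutes set p \<and> sign \<kappa> = (-1) ^ card (set (vwalk_arcs p)) \<and> \<kappa> (hd p) = last p
    \<and> (\<forall>(u, v) \<in> set (vwalk_arcs p). \<kappa> v = u)"
  using assms
proof (induction p rule: vwalk_arcs.induct)
  case (2 x)
  show ?case by (rule exI[of _ id]) (auto simp: permutes_id id_def)
next
  case (3 x y xs)
  then obtain \<kappa> where \<kappa>: "\<kappa> permutes set (y # xs)" "sign \<kappa> = (-1) ^ card (set (vwalk_arcs (y # xs)))"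
    "\<kappa> y = last (y # xs)" "\<And>u v. (u, v) \<in> set (vwalk_arcs (y # xs)) \<Longrightarrow> \<kappa> v = u" by auto
  have x: "x \<noteq> y" "x \<notin> set (y # xs)" using 3(2) by auto
  have \<kappa>x: "\<kappa> x = x" using \<kappa>(1) x(2) by (rule permutes_not_in)
  have "\<kappa> permutes set (x # y # xs)" using \<kappa>(1) by (rule permutes_subset) auto
  then have perm: "\<kappa> \<circ> transpose x y permutes set (x # y # xs)"
    by (rule permutes_compose[rotated]) (simp add: permutes_swap_id)
  have "permutation \<kappa>" using \<kappa>(1) permutation_permutes by blast
  then have "sign (\<kappa> \<circ> transpose x y) = - sign \<kappa>"
    using x by (simp add: sign_compose permutation_swap_id sign_swap_id)
  also have "\<dots> = (-1) ^ card (set (vwalk_arcs (x # y # xs)))"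
    using x \<kappa>(2) by (auto simp: card_insert_if dest: vwalk_arcs_in_set)
  finally have sgn: "sign (\<kappa> \<circ> transpose x y) = (-1) ^ card (set (vwalk_arcs (x # y # xs)))" .
  have "(\<kappa> \<circ> transpose x y) v = u" if "(u, v) \<in> set (vwalk_arcs (x # y # xs))" for u v
  proof (cases "(u, v) = (x, y)")
    case True
    then show ?thesis using \<kappa>x by simp
  next
    case False
    then have uv: "(u, v) \<in> set (vwalk_arcs (y # xs))" using that by auto
    then have "v \<noteq> y" "v \<noteq> x" using vwalk_arc_not_hd[of "y # xs" u v] 3(2) x vwalk_arcs_in_set[OF uv] by auto
    then show ?thesis using \<kappa>(4)[OF uv] by (simp add: transpose_def)
  qed
  then have "\<forall>(u, v) \<in> set (vwalk_arcs (x # y # xs)). (\<kappa> \<circ> transpose x y) v = u" by blast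
  moreover have "(\<kappa> \<circ> transpose x y) (hd (x # y # xs)) = last (x # y # xs)" using \<kappa>(3) by simp
  ultimately show ?case using perm sgn by blast
qed simp

lemma disjoint_paths_cycles:
  assumes "finite R" "\<And>p. p \<in> R \<Longrightarrow> distinct p \<and> p \<noteq> []"
    "\<And>p q. p \<in> R \<Longrightarrow> q \<in> R \<Longrightarrow> p \<noteq> q \<Longrightarrow> set p \<inter> set q = {}"
  shows "\<exists>\<kappa>. \<kappa> permutes (\<Union>p\<in>R. set p) \<and> sign \<kappa> = (-1) ^ card (routing_arcs R)
    \<and> (\<forall>p\<in>R. \<kappa> (hd p) = last p) \<and> (\<forall>(u, v) \<in> routing_arcs R. \<kappa> v = u)"
  using assms
proof (induction R rule: finite_induct)
  case empty
  show ?case by (rule exI[of _ id]) (auto simp: permutes_id id_def routing_arcs_def)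
next
  case (insert p R)
  obtain \<kappa> where \<kappa>: "\<kappa> permutes (\<Union>p\<in>R. set p)" "sign \<kappa> = (-1) ^ card (routing_arcs R)"
    "\<And>p. p \<in> R \<Longrightarrow> \<kappa> (hd p) = last p" "\<And>u v. (u, v) \<in> routing_arcs R \<Longrightarrow> \<kappa> v = u"
  proof -
    have "\<exists>\<kappa>. \<kappa> permutes (\<Union>p\<in>R. set p) \<and> sign \<kappa> = (-1) ^ card (routing_arcs R)
      \<and> (\<forall>p\<in>R. \<kappa> (hd p) = last p) \<and> (\<forall>(u, v) \<in> routing_arcs R. \<kappa> v = u)"
      using insert.prems by (intro insert.IH) auto
    then show ?thesis using that by blast
  qed
  have p: "distinct p" "p \<noteq> []" using insert.prems(1) by auto
  obtain \<mu> where \<mu>: "\<mu> permutes set p" "sign \<mu> = (-1) ^ card (set (vwalk_arcs p))" "\<mu> (hd p) = last p"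
    "\<And>u v. (u, v) \<in> set (vwalk_arcs p) \<Longrightarrow> \<mu> v = u"
    using path_cycle[OF p] by auto
  have disj: "set p \<inter> (\<Union>p\<in>R. set p) = {}" using insert.prems(2)[of p] insert.hyps(2) by auto
  have finR: "finite (\<Union>p\<in>R. set p)" "finite (routing_arcs R)" using insert.hyps(1) by (auto simp: routing_arcs_def)
  have \<mu>out: "\<mu> v = v" if "v \<in> (\<Union>p\<in>R. set p)" for v using \<mu>(1) disj that by (blast intro: permutes_not_in)
  have \<kappa>out: "\<kappa> v = v" if "v \<in> set p" for v using \<kappa>(1) disj that by (blast intro: permutes_not_in)
  have arcs_in: "v \<in> (\<Union>p\<in>R. set p)" if "(u, v) \<in> routing_arcs R" for u v
    using that vwalk_arcs_in_set by (fastforce simp: routing_arcs_def)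
  have ra: "routing_arcs (insert p R) = set (vwalk_arcs p) \<union> routing_arcs R" by (simp add: routing_arcs_def)
  have "False" if "(u, v) \<in> set (vwalk_arcs p)" "(u, v) \<in> routing_arcs R" for u v
    using arcs_in[OF that(2)] vwalk_arcs_in_set[OF that(1)] disj by blast
  then have "set (vwalk_arcs p) \<inter> routing_arcs R = {}" by auto
  then have card: "card (routing_arcs (insert p R)) = card (set (vwalk_arcs p)) + card (routing_arcs R)"
    unfolding ra using finR by (simp add: card_Un_disjoint)
  have "\<kappa> \<circ> \<mu> permutes (\<Union>p\<in>insert p R. set p)"
    by (rule permutes_compose) (use \<kappa>(1) \<mu>(1) in \<open>auto intro: permutes_subset\<close>)
  moreover have "sign (\<kappa> \<circ> \<mu>) = (-1) ^ card (routing_arcs (insert p R))"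
  proof -
    have "permutation \<kappa>" "permutation \<mu>" using \<kappa>(1) \<mu>(1) finR(1) permutation_permutes by blast+
    then show ?thesis by (simp add: sign_compose \<kappa>(2) \<mu>(2) card power_add)
  qed
  moreover have "(\<kappa> \<circ> \<mu>) (hd q) = last q" if "q \<in> insert p R" for q
  proof (cases "q = p")
    case True
    then show ?thesis using \<mu>(3) \<kappa>out[of "last p"] p by simp
  next
    case False
    then have q: "q \<in> R" "q \<noteq> []" using that insert.prems(1) by auto
    then have "hd q \<in> (\<Union>p\<in>R. set p)" using hd_in_set by blast
    then show ?thesis using \<mu>out \<kappa>(3)[OF q(1)] by simp
  qed
  moreover have "(\<kappa> \<circ> \<mu>) v = u" if "(u, v) \<in> routing_arcs (insert p R)" for u v
  proof (cases "(u, v) \<in> set (vwalk_arcs p)")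
    case True
    then show ?thesis using \<mu>(4) \<kappa>out[of u] vwalk_arcs_in_set[OF True] by simp
  next
    case False
    then have "(u, v) \<in> routing_arcs R" using that ra by auto
    then show ?thesis using \<mu>out[OF arcs_in] \<kappa>(4) by simp
  qed
  ultimately show ?case by blast
qed

section \<open>Routings in acyclic digraphs as permutations\<close>

locale acyclic_pair_digraph =
  fixes D :: "'v pair_pre_digraph"
  assumes fin_digraph: "pair_fin_digraph D" and no_cycle: "acyclic_digraph D"
begin

abbreviation "V \<equiv> pverts D"
abbreviation "A \<equiv> parcs D"

lemma finite_V: "finite V" and finite_A: "finite A" and arcs_in_V: "A \<subseteq> V \<times> V"
proof -
  interpret pair_fin_digraph D by (rule fin_digraph)
  show "finite V" "finite A" by (rule pair_finite_verts, rule pair_finite_arcs)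
  show "A \<subseteq> V \<times> V" using wellformed' by auto
qed

lemma vpath_iff: "vpath p (with_proj D) \<longleftrightarrow> p \<noteq> [] \<and> set p \<subseteq> V \<and> set (vwalk_arcs p) \<subseteq> A \<and> distinct p"
  by (auto simp: vpath_def vwalk_def)

text \<open>
  A closed walk along the transitive closure yields a cycle: an arc \<open>(v, u)\<close> followed by
  a path from \<open>u\<close> back to \<open>v\<close>.
\<close>
lemma acyclic_A: "acyclic A"
proof (rule acyclicI, rule allI, rule notI)
  fix v assume "(v, v) \<in> A\<^sup>+"
  then obtain u where vu: "(v, u) \<in> A" and uv: "(u, v) \<in> A\<^sup>*" by (meson tranclD)
  interpret pair_fin_digraph D by (rule fin_digraph)
  have uV: "u \<in> V" "v \<in> V" using vu arcs_in_V by auto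
  have "u \<rightarrow>\<^sup>*\<^bsub>with_proj D\<^esub> v" using uv uV by (simp add: reachable_conv)
  then obtain p where p: "vpath p (with_proj D)" "hd p = u" "last p = v"
    using reachable_vpath_conv by blast
  then have p': "p \<noteq> []" "distinct p" by (auto simp: vpath_iff)
  have walk: "vwalk (v # p) (with_proj D)"
    using p vu uV by (intro vwalk_consI) auto
  have eq: "butlast (v # p) = v # butlast p" using p' by simp
  have pb: "p = butlast p @ [v]" using p' p(3) by (metis append_butlast_last_id)
  have d: "distinct (v # butlast p)" using p'(2) by (subst (asm) pb) auto
  have "set (vwalk_arcs (butlast (v # p))) \<subseteq> set (vwalk_arcs (v # p))"
    using set_vwalk_arcs_append1[of "butlast (v # p)" "[last (v # p)]"]
    by (metis append_butlast_last_id list.distinct(1))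
  moreover have "set (butlast (v # p)) \<subseteq> set (v # p)" using in_set_butlastD by fastforce
  ultimately have "vpath (butlast (v # p)) (with_proj D)"
    using walk d unfolding vpath_def vwalk_def eq by auto
  then have "vcycle D (v # p)"
    unfolding vcycle_def using walk p p' by (cases p) auto
  then show False using no_cycle by (auto simp: acyclic_digraph_def)
qed

lemma wf_A: "wf A" and wf_converse_A: "wf (A\<inverse>)"
  using finite_A acyclic_A by (simp_all add: finite_acyclic_wf finite_acyclic_wf_converse)

text \<open>
  The permutations with nonzero term in the Leibniz expansion of the matrix that has the unit
  vectors at \<open>\<tau> x\<close> as columns \<open>x \<in> X\<close> and the columns of \<open>I - W\<close> elsewhere.
\<close>
definition linking_perms :: "'v set \<Rightarrow> ('v \<Rightarrow> 'v) \<Rightarrow> ('v \<Rightarrow> 'v) set" where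
  "linking_perms X \<tau> = {\<pi>. \<pi> permutes V \<and> (\<forall>x\<in>X. \<pi> x = \<tau> x)
     \<and> (\<forall>v\<in>V - X. \<pi> v \<noteq> v \<longrightarrow> (\<pi> v, v) \<in> A)}"

definition perm_arcs :: "'v set \<Rightarrow> ('v \<Rightarrow> 'v) \<Rightarrow> ('v \<times> 'v) set" where
  "perm_arcs X \<pi> = (\<lambda>v. (\<pi> v, v)) ` {v \<in> V - X. \<pi> v \<noteq> v}"

lemma routingD:
  assumes "routing D X T R"
  shows "p \<in> R \<Longrightarrow> p \<noteq> [] \<and> set p \<subseteq> V \<and> set (vwalk_arcs p) \<subseteq> A \<and> distinct p \<and> hd p \<in> X \<and> last p \<in> T"
    and "x \<in> X \<Longrightarrow> \<exists>p\<in>R. hd p = x"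
    and "p \<in> R \<Longrightarrow> q \<in> R \<Longrightarrow> z \<in> set p \<Longrightarrow> z \<in> set q \<Longrightarrow> p = q"
  using assms unfolding routing_def vpath_iff by blast+

lemma routing_arcs_subset: "routing D X T R \<Longrightarrow> routing_arcs R \<subseteq> A"
  using routingD(1) by (fastforce simp: routing_arcs_def)

lemma routing_inj_hd: "routing D X T R \<Longrightarrow> inj_on hd R"
  using routingD(1,3) by (metis hd_in_set inj_onI)

lemma routing_inj_last: "routing D X T R \<Longrightarrow> inj_on last R"
  using routingD(1,3) by (metis last_in_set inj_onI)

lemma routing_hd_image: "routing D X T R \<Longrightarrow> hd ` R = X"
  using routingD(1,2) by fastforce

lemma routing_card_ends: 
  assumes "routing D X T R"
  shows "card (last ` R) = card X" "last ` R \<subseteq> T"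
  using routingD(1)[OF assms] card_image[OF routing_inj_last[OF assms]] card_image[OF routing_inj_hd[OF assms]]
    routing_hd_image[OF assms] by auto

lemma routing_finite:
  assumes "routing D X T R" "finite X"
  shows "finite R"
  using routing_hd_image[OF assms(1)] routing_inj_hd[OF assms(1)] assms(2) finite_imageD by metis

lemma routing_mono: "routing D X S R \<Longrightarrow> S \<subseteq> T \<Longrightarrow> routing D X T R"
  unfolding routing_def by blast

lemma routing_arc_target: 
  assumes R: "routing D X T R" and "(u, v) \<in> routing_arcs R"
  shows "v \<notin> X" "u \<noteq> v"
proof -
  obtain p where p: "p \<in> R" "(u, v) \<in> set (vwalk_arcs p)" using assms(2) by (auto simp: routing_arcs_def)
  have d: "distinct p" using routingD(1)[OF R p(1)] by blast
  show "u \<noteq> v" using vwalk_arc_not_hd[OF d p(2)] by blast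
  show "v \<notin> X"
  proof
    assume "v \<in> X"
    then obtain q where q: "q \<in> R" "hd q = v" using routingD(2)[OF R] by blast
    then have "v \<in> set q" using routingD(1)[OF R q(1)] by auto
    then have "p = q" using routingD(3)[OF R p(1) q(1)] vwalk_arcs_in_set[OF p(2)] by blast
    then show False using vwalk_arc_not_hd[OF d p(2)] q(2) by simp
  qed
qed

lemma routing_arcs_target_unique:
  assumes R: "routing D X T R" and "(u, v) \<in> routing_arcs R" "(u, v') \<in> routing_arcs R"
  shows "v = v'"
proof -
  obtain p where p: "p \<in> R" "(u, v) \<in> set (vwalk_arcs p)" using assms(2) by (auto simp: routing_arcs_def)
  obtain q where q: "q \<in> R" "(u, v') \<in> set (vwalk_arcs q)" using assms(3) by (auto simp: routing_arcs_def)
  have "p = q" using routingD(3)[OF R p(1) q(1)] vwalk_arcs_in_set p(2) q(2) by fast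
  then show ?thesis using vwalk_arc_target_unique p(2) q(2) routingD(1)[OF R p(1)] by fast
qed

lemma routing_last_no_arc:
  assumes R: "routing D X T R" and "p \<in> R"
  shows "(last p, v) \<notin> routing_arcs R"
proof
  assume "(last p, v) \<in> routing_arcs R"
  then obtain q where q: "q \<in> R" "(last p, v) \<in> set (vwalk_arcs q)" by (auto simp: routing_arcs_def)
  have "p = q" using routingD(3)[OF R assms(2) q(1), of "last p"] vwalk_arcs_in_set[OF q(2)] routingD(1)[OF R assms(2)] by simp
  then show False using vwalk_arc_not_last[of q "last p" v] q(2) routingD(1)[OF R q(1)] by blast
qed

lemma walks_with_common_arcs_equal:
  assumes "p \<noteq> []" "q \<noteq> []" "hd p = hd q"
    "set (vwalk_arcs p) \<subseteq> F" "set (vwalk_arcs q) \<subseteq> F"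
    "\<And>u v v'. (u, v) \<in> F \<Longrightarrow> (u, v') \<in> F \<Longrightarrow> v = v'"
    "\<And>v. (last p, v) \<notin> F" "\<And>v. (last q, v) \<notin> F"
  shows "p = q"
  using assms(1-5,7,8)
proof (induction p arbitrary: q rule: vwalk_arcs.induct)
  case (2 x)
  then show ?case by (cases q rule: vwalk_arcs.cases) auto
next
  case (3 x y xs)
  show ?case
  proof (cases q rule: vwalk_arcs.cases)
    case (3 x' y' ys)
    then have "x' = x" "(x, y) \<in> F" "(x, y') \<in> F" using "3.prems" by auto
    moreover then have "y = y'" using assms(6) by blast
    ultimately show ?thesis using "3.IH"[of "y' # ys"] "3.prems" 3 by auto
  qed (use "3.prems" in auto)
qed simp

text \<open>
  A path of the routing is recovered from its first vertex by following the only available arc until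
  there is none.
\<close>
lemma routing_determined_by_arcs:
  assumes R: "routing D X T R" and Q: "routing D X T' Q" and eq: "routing_arcs R = routing_arcs Q"
  shows "R = Q"
proof -
  have "R' \<subseteq> Q'" if R': "routing D X S R'" and Q': "routing D X S' Q'" and eq': "routing_arcs R' = routing_arcs Q'"
    for R' Q' S S'
  proof
    fix p assume p: "p \<in> R'"
    then obtain q where q: "q \<in> Q'" "hd q = hd p" using routingD(1)[OF R' p] routingD(2)[OF Q'] by blast
    have "p = q"
    proof (rule walks_with_common_arcs_equal[where F = "routing_arcs R'"])
      show "p \<noteq> []" "q \<noteq> []" using routingD(1)[OF R' p] routingD(1)[OF Q' q(1)] by blast+
      show "set (vwalk_arcs p) \<subseteq> routing_arcs R'" using p by (auto simp: routing_arcs_def)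
      show "set (vwalk_arcs q) \<subseteq> routing_arcs R'" unfolding eq' using q by (auto simp: routing_arcs_def)
      show "\<And>v. (last p, v) \<notin> routing_arcs R'" by (rule routing_last_no_arc[OF R' p])
      show "\<And>v. (last q, v) \<notin> routing_arcs R'" unfolding eq' by (rule routing_last_no_arc[OF Q' q(1)])
    qed (use q routing_arcs_target_unique[OF R'] in auto)
    then show "p \<in> Q'" using q(1) by simp
  qed
  from this[OF R Q eq] this[OF Q R eq[symmetric]] show ?thesis by blast
qed

lemma linking_perm_determined_by_arcs:
  assumes "\<pi> \<in> linking_perms X \<tau>" "\<pi>' \<in> linking_perms X \<tau>" "perm_arcs X \<pi> = perm_arcs X \<pi>'"
  shows "\<pi> = \<pi>'"
proof
  fix v
  consider "v \<in> X" | "v \<notin> V" | "v \<in> V - X" by blast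
  then show "\<pi> v = \<pi>' v"
  proof cases
    case 1
    then show ?thesis using assms by (auto simp: linking_perms_def)
  next
    case 2
    then show ?thesis using assms by (auto simp: linking_perms_def permutes_not_in)
  next
    case 3
    have "(\<rho> v, v) \<in> perm_arcs X \<rho> \<longleftrightarrow> \<rho> v \<noteq> v" "(u, v) \<in> perm_arcs X \<rho> \<Longrightarrow> u = \<rho> v" for \<rho> u
      using 3 by (auto simp: perm_arcs_def)
    then show ?thesis using assms(3) by metis
  qed
qed

text \<open>
  From a vertex in \<open>X\<close>, or from one that is moved, the inverse of \<open>\<pi>\<close> leads forward along an arc
  to another moved vertex unless the vertex is in \<open>\<tau> ` X\<close>. By acyclicity this stops, which gives the paths. They
  are disjoint as arcs of \<open>\<pi>\<close> are determined by their heads. Acyclicity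
  also excludes further arcs: going backwards from a moved vertex must lead into \<open>X\<close>.
\<close>
lemma routing_of_linking_perm:
  assumes \<pi>: "\<pi> \<in> linking_perms X \<tau>" and X: "X \<subseteq> V"
  shows "\<exists>R. routing D X (\<tau> ` X) R \<and> routing_arcs R = perm_arcs X \<pi>"
proof -
  let ?F = "perm_arcs X \<pi>" and ?S = "\<tau> ` X"
  have perm: "\<pi> permutes V" and onX: "\<And>x. x \<in> X \<Longrightarrow> \<pi> x = \<tau> x"
    and arc: "\<And>v. v \<in> V - X \<Longrightarrow> \<pi> v \<noteq> v \<Longrightarrow> (\<pi> v, v) \<in> A"
    using \<pi> by (auto simp: linking_perms_def)
  have inj: "\<And>u v. \<pi> u = \<pi> v \<Longrightarrow> u = v" using perm by (metis permutes_inj injD)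
  have FA: "?F \<subseteq> A" using arc by (auto simp: perm_arcs_def)
  have F_iff: "(u, v) \<in> ?F \<longleftrightarrow> v \<in> V - X \<and> \<pi> v = u \<and> u \<noteq> v" for u v by (auto simp: perm_arcs_def)
  have fwd: "\<exists>p. p \<noteq> [] \<and> hd p = u \<and> last p \<in> ?S \<and> set (vwalk_arcs p) \<subseteq> ?F" if "u \<in> X \<or> \<pi> u \<noteq> u" for u
    using that
  proof (induction u rule: wf_induct_rule[OF wf_converse_A])
    case (1 u)
    show ?case
    proof (cases "u \<in> ?S")
      case True
      then show ?thesis by (intro exI[of _ "[u]"]) simp
    next
      case False
      have uV: "u \<in> V" using 1(2) X perm by (auto simp: permutes_def)
      obtain v where v: "\<pi> v = u" using perm by (metis permutes_surj surjD)
      have vX: "v \<notin> X" using False v onX by force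
      have "v \<noteq> u" using 1(2) v vX by auto
      moreover have "v \<in> V" using uV v perm by (metis permutes_in_image)
      ultimately have F: "(u, v) \<in> ?F" using v vX by (auto simp: F_iff)
      then have "(v, u) \<in> A\<inverse>" using FA by auto
      then obtain p where p: "p \<noteq> []" "hd p = v" "last p \<in> ?S" "set (vwalk_arcs p) \<subseteq> ?F"
        using 1(1)[of v] \<open>v \<noteq> u\<close> v by auto
      then show ?thesis using F by (intro exI[of _ "u # p"]) auto
    qed
  qed
  then obtain P where P: "\<And>x. x \<in> X \<Longrightarrow> P x \<noteq> [] \<and> hd (P x) = x \<and> last (P x) \<in> ?S \<and> set (vwalk_arcs (P x)) \<subseteq> ?F"
    by metis
  have meet: "x = y" if "x \<in> X" "y \<in> X" "z \<in> set (P x)" "z \<in> set (P y)" for x y z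
    using that
  proof (induction z rule: wf_induct_rule[OF wf_A])
    case (1 z)
    have noarc: "\<And>u. (u, z) \<in> ?F \<Longrightarrow> z \<noteq> x \<and> z \<noteq> y" using 1(2,3) by (auto simp: F_iff)
    have pred: "z = w \<or> (\<exists>u. (u, z) \<in> set (vwalk_arcs (P w)))" if "w \<in> X" "z \<in> set (P w)" for w
      using that P[of w] vwalk_arc_into[of z "P w"] by auto
    show ?case
    proof (cases "z = x \<or> z = y")
      case True
      then show ?thesis using pred[OF 1(2,4)] pred[OF 1(3,5)] noarc P[OF 1(2)] P[OF 1(3)] by blast
    next
      case False
      then obtain u u' where u: "(u, z) \<in> set (vwalk_arcs (P x))" "(u', z) \<in> set (vwalk_arcs (P y))"
        using pred[OF 1(2,4)] pred[OF 1(3,5)] by blast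
      then have "(u, z) \<in> ?F" "(u', z) \<in> ?F" using P 1(2,3) by blast+
      then have "u = u'" "(u, z) \<in> A" using FA by (auto simp: F_iff)
      moreover have "u \<in> set (P x)" "u' \<in> set (P y)" using u vwalk_arcs_in_set by fast+
      ultimately show ?thesis using 1(1)[of u] 1(2,3) by simp
    qed
  qed
  define R where "R = P ` X"
  have R: "routing D X ?S R"
    unfolding routing_def vpath_iff
  proof (intro conjI ballI impI)
    fix p assume "p \<in> R"
    then obtain x where x: "x \<in> X" "p = P x" by (auto simp: R_def)
    show "p \<noteq> []" "hd p \<in> X" "last p \<in> ?S" using P[OF x(1)] x by auto
    show A: "set (vwalk_arcs p) \<subseteq> A" using P[OF x(1)] x FA by auto
    then show "distinct p" using acyclic_walk_distinct acyclic_A by blast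
    have "snd ` set (vwalk_arcs p) \<subseteq> V" using A arcs_in_V by auto
    moreover have "hd p \<in> V" using P[OF x(1)] x X by auto
    ultimately show "set p \<subseteq> V" using walk_set_subset[of p] by blast
  next
    fix x assume "x \<in> X" then show "\<exists>p\<in>R. hd p = x" using P by (auto simp: R_def)
  next
    fix p q assume "p \<in> R" "q \<in> R" "p \<noteq> q"
    then show "set p \<inter> set q = {}" using meet by (auto simp: R_def)
  qed
  \<comment> \<open>acyclicity makes it possible to walk back from any moved vertex to X\<close>
  have main: "(\<exists>p\<in>R. v \<in> set p) \<and> (v \<notin> X \<longrightarrow> (\<pi> v, v) \<in> routing_arcs R)" if "v \<in> X \<or> \<pi> v \<noteq> v" for v
    using that
  proof (induction v rule: wf_induct_rule[OF wf_A])
    case (1 v)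
    show ?case
    proof (cases "v \<in> X")
      case True
      then show ?thesis using P[OF True] hd_in_set[of "P v"] by (auto simp: R_def)
    next
      case False
      have vV: "v \<in> V - X" "\<pi> v \<noteq> v" using False 1(2) perm by (auto simp: permutes_def)
      let ?u = "\<pi> v"
      have "?u \<in> X \<or> \<pi> ?u \<noteq> ?u" using inj[of ?u v] vV(2) by auto
      then obtain p where p: "p \<in> R" "?u \<in> set p" using 1(1)[OF arc[OF vV]] by blast
      have "?u \<notin> ?S"
      proof
        assume "?u \<in> ?S"
        then obtain x where "x \<in> X" "\<pi> v = \<pi> x" using onX by auto
        then show False using inj False by blast
      qed
      then have "?u \<noteq> last p" using routingD(1)[OF R p(1)] by auto
      then obtain v' where v': "(?u, v') \<in> set (vwalk_arcs p)" using vwalk_arc_out_of p(2) by metis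
      then have "(?u, v') \<in> ?F" using p(1) P by (auto simp: R_def)
      then have "v' = v" using inj by (auto simp: F_iff)
      then show ?thesis using v' p(1) vwalk_arcs_in_set[OF v'] by (auto simp: routing_arcs_def)
    qed
  qed
  have "routing_arcs R = ?F"
  proof
    show "routing_arcs R \<subseteq> ?F" using P by (auto simp: routing_arcs_def R_def)
    show "?F \<subseteq> routing_arcs R"
    proof clarify
      fix u v assume "(u, v) \<in> ?F"
      then show "(u, v) \<in> routing_arcs R" using main[of v] by (auto simp: F_iff)
    qed
  qed
  then show ?thesis using R by blast
qed

lemma routing_end_fun:
  assumes R: "routing D X T R"
  shows "\<exists>P. (\<forall>x\<in>X. P x \<in> R \<and> hd (P x) = x) \<and> (\<forall>p\<in>R. P (hd p) = p)"
proof -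
  obtain P where P: "\<forall>x\<in>X. P x \<in> R \<and> hd (P x) = x" using routingD(2)[OF R] by metis
  have "P (hd p) = p" if "p \<in> R" for p
    using routing_inj_hd[OF R] P routingD(1)[OF R that] that by (metis inj_onD)
  then show ?thesis using P by blast
qed

text \<open>
  Let \<open>\<kappa>\<close> be the product of the cycles along the paths of \<open>R\<close>. It has the right arcs, but sends the start
  of a path to its end instead of the prescribed value \<open>\<tau>\<close>. The permutation \<open>\<chi>\<close> of \<open>X\<close> that
  measures the difference corrects this, and \<open>\<pi> = \<kappa> \<circ> \<chi>\<inverse>\<close>. In the sign, the arcs cancel
  against those of \<open>\<kappa>\<close>.
\<close>
lemma linking_perm_of_routing:
  assumes R: "routing D X T R" and X: "X \<subseteq> V" and \<tau>: "bij_betw \<tau> X (last ` R)"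
  shows "\<exists>\<pi>\<in>linking_perms X \<tau>. perm_arcs X \<pi> = routing_arcs R \<and>
     (\<exists>\<chi>. \<chi> permutes X \<and> (\<forall>p\<in>R. \<tau> (\<chi> (hd p)) = last p) \<and> sign \<pi> * (-1) ^ card (routing_arcs R) = sign \<chi>)"
proof -
  have finX: "finite X" using X finite_V finite_subset by blast
  have finR: "finite R" using routing_finite[OF R finX] .
  let ?U = "\<Union>p\<in>R. set p"
  obtain \<kappa> where \<kappa>: "\<kappa> permutes ?U" "sign \<kappa> = (-1) ^ card (routing_arcs R)"
    "\<And>p. p \<in> R \<Longrightarrow> \<kappa> (hd p) = last p" "\<And>u v. (u, v) \<in> routing_arcs R \<Longrightarrow> \<kappa> v = u"
  proof -
    have "\<exists>\<kappa>. \<kappa> permutes ?U \<and> sign \<kappa> = (-1) ^ card (routing_arcs R)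
      \<and> (\<forall>p\<in>R. \<kappa> (hd p) = last p) \<and> (\<forall>(u, v) \<in> routing_arcs R. \<kappa> v = u)"
      using finR routingD(1)[OF R] routingD(3)[OF R] by (intro disjoint_paths_cycles) blast+
    then show ?thesis using that by blast
  qed
  have UV: "?U \<subseteq> V" using routingD(1)[OF R] by blast
  obtain P where P: "\<And>x. x \<in> X \<Longrightarrow> P x \<in> R \<and> hd (P x) = x" "\<And>p. p \<in> R \<Longrightarrow> P (hd p) = p"
    using routing_end_fun[OF R] by blast
  define e where "e = (\<lambda>x. last (P x))"
  have einj: "inj_on e X"
  proof (rule inj_onI)
    fix x y assume xy: "x \<in> X" "y \<in> X" "e x = e y"
    then have "P x = P y" using inj_onD[OF routing_inj_last[OF R]] P(1) unfolding e_def by blast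
    then show "x = y" using P(1) xy(1,2) by metis
  qed
  have eim: "e ` X \<subseteq> last ` R" using P by (auto simp: e_def)
  define \<chi> where "\<chi> = (\<lambda>x. if x \<in> X then inv_into X \<tau> (e x) else x)"
  have \<tau>im: "\<tau> ` X = last ` R" using \<tau> by (simp add: bij_betw_def)
  have \<tau>\<chi>: "\<tau> (\<chi> x) = e x" "\<chi> x \<in> X" if "x \<in> X" for x
    using that eim \<tau>im f_inv_into_f[of "e x" \<tau> X] inv_into_into[of "e x" \<tau> X] by (auto simp: \<chi>_def)
  have "inj_on \<chi> X" using einj \<tau>\<chi>(1) by (metis inj_on_def)
  moreover have "\<chi> ` X \<subseteq> X" using \<tau>\<chi>(2) by auto
  ultimately have "bij_betw \<chi> X X" using endo_inj_surj[OF finX] by (auto simp: bij_betw_def)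
  then have \<chi>: "\<chi> permutes X" by (rule bij_imp_permutes) (simp add: \<chi>_def)
  have i\<chi>: "inv \<chi> permutes X" using \<chi> by (rule permutes_inv)
  define \<pi> where "\<pi> = \<kappa> \<circ> inv \<chi>"
  have \<pi>V: "\<pi> permutes V" unfolding \<pi>_def
    by (rule permutes_compose) (use i\<chi> \<kappa>(1) X UV in \<open>auto intro: permutes_subset\<close>)
  have \<pi>out: "\<pi> v = \<kappa> v" if "v \<notin> X" for v using permutes_not_in[OF i\<chi> that] by (simp add: \<pi>_def)
  have into: "(\<kappa> v, v) \<in> routing_arcs R" if v: "v \<notin> X" "\<kappa> v \<noteq> v" for v
  proof -
    have "v \<in> ?U" using v(2) \<kappa>(1) by (auto simp: permutes_def)
    then obtain p where p: "p \<in> R" "v \<in> set p" by blast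
    then have "v \<noteq> hd p" using routingD(1)[OF R p(1)] v(1) by auto
    then obtain u where "(u, v) \<in> set (vwalk_arcs p)" using vwalk_arc_into p(2) by metis
    then have "(u, v) \<in> routing_arcs R" using p(1) by (auto simp: routing_arcs_def)
    then show ?thesis using \<kappa>(4) by simp
  qed
  have "\<pi> \<in> linking_perms X \<tau>"
    unfolding linking_perms_def
  proof (intro CollectI conjI ballI impI)
    show "\<pi> permutes V" by (rule \<pi>V)
    fix x assume x: "x \<in> X"
    let ?y = "inv \<chi> x"
    have y: "?y \<in> X" "\<chi> ?y = x" using x i\<chi> \<chi> by (auto simp: permutes_in_image permutes_inverses)
    have "\<kappa> ?y = e ?y" using \<kappa>(3)[of "P ?y"] P(1)[OF y(1)] by (simp add: e_def)
    then show "\<pi> x = \<tau> x" using \<tau>\<chi>(1)[OF y(1)] y(2) by (simp add: \<pi>_def)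
  next
    fix v assume "v \<in> V - X" "\<pi> v \<noteq> v"
    then show "(\<pi> v, v) \<in> A" using into[of v] \<pi>out[of v] routing_arcs_subset[OF R] by auto
  qed
  moreover have "perm_arcs X \<pi> = routing_arcs R"
  proof (intro set_eqI iffI)
    fix a assume "a \<in> perm_arcs X \<pi>"
    then show "a \<in> routing_arcs R" using into \<pi>out by (auto simp: perm_arcs_def)
  next
    fix a assume a: "a \<in> routing_arcs R"
    obtain u v where uv: "a = (u, v)" by force
    have v: "v \<notin> X" "u \<noteq> v" using routing_arc_target[OF R] a uv by blast+
    have "v \<in> V" using a uv routing_arcs_subset[OF R] arcs_in_V by auto
    moreover have "\<pi> v = u" using \<pi>out[OF v(1)] \<kappa>(4) a uv by auto
    ultimately show "a \<in> perm_arcs X \<pi>" using v uv by (auto simp: perm_arcs_def)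
  qed
  moreover have "\<tau> (\<chi> (hd p)) = last p" if "p \<in> R" for p
    using \<tau>\<chi>(1)[of "hd p"] routingD(1)[OF R that] P(2)[OF that] by (simp add: e_def)
  moreover have "sign \<pi> * (-1) ^ card (routing_arcs R) = sign \<chi>"
  proof -
    have "permutation \<kappa>" using \<kappa>(1) finR permutation_permutes by blast
    moreover have p\<chi>: "permutation \<chi>" using \<chi> finX permutation_permutes by blast
    moreover have "permutation (inv \<chi>)" using i\<chi> finX permutation_permutes by blast
    ultimately have "sign \<pi> = sign \<kappa> * sign \<chi>" unfolding \<pi>_def by (simp add: sign_compose sign_inverse)
    then show ?thesis unfolding \<kappa>(2) by (simp add: mult_ac flip: power_add mult_2)
  qed
  ultimately show ?thesis using \<chi> by blast
qed

end

section \<open>Comparing routings by weight\<close>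

lemma sum_powers_less:
  fixes b m :: nat
  assumes "b \<ge> 2" "F \<subseteq> {..<m}"
  shows "(b - 1) * (\<Sum>e\<in>F. b ^ e) < b ^ m"
proof -
  have "(\<Sum>e\<in>F. b ^ e) \<le> (\<Sum>e<m. b ^ e)"
    using assms(2) by (intro sum_mono2) auto
  then have "(b - 1) * (\<Sum>e\<in>F. b ^ e) \<le> (b - 1) * (\<Sum>e<m. b ^ e)" by simp
  also have "\<dots> = b ^ m - 1" 
  proof -
    have "(b - 1) * (\<Sum>e<m. b ^ e) + 1 = b ^ m"
    proof (induction m)
      case (Suc m)
      have "(b - 1) * (\<Sum>e<Suc m. b ^ e) + 1 = ((b - 1) * (\<Sum>e<m. b ^ e) + 1) + (b - 1) * b ^ m"
        by (simp add: algebra_simps)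
      also have "\<dots> = b ^ m + (b - 1) * b ^ m" using Suc by simp
      also have "\<dots> = b ^ Suc m" using assms(1) by (simp add: diff_mult_distrib)
      finally show ?case .
    qed simp
    then show ?thesis by simp
  qed
  also have "\<dots> < b ^ m" using assms(1) by simp
  finally show ?thesis .
qed

text \<open>
  Base three rather than two, since a sum of distinct smaller powers of three is less than half of
  the next one: this gives the margin needed to compare different determinants.
\<close>
lemma dominated_sum:
  fixes \<epsilon> :: "'a \<Rightarrow> real" and f :: "'a \<Rightarrow> nat"
  assumes "finite Q" "inj_on f Q" "\<And>x. x \<in> Q \<Longrightarrow> f x < m" "\<And>x. x \<in> Q \<Longrightarrow> \<bar>\<epsilon> x\<bar> = 1"
  shows "2 * \<bar>\<Sum>x\<in>Q. \<epsilon> x * 3 ^ f x\<bar> < 3 ^ m"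
proof -
  have "\<bar>\<Sum>x\<in>Q. \<epsilon> x * 3 ^ f x\<bar> \<le> (\<Sum>x\<in>Q. \<bar>\<epsilon> x * 3 ^ f x\<bar>)" by (rule sum_abs)
  also have "\<dots> = (\<Sum>x\<in>Q. 3 ^ f x)" using assms(4) by (simp add: abs_mult)
  also have "\<dots> = (\<Sum>e\<in>f ` Q. 3 ^ e)" by (rule sum.reindex_cong[OF assms(2), symmetric]) auto
  also have "\<dots> = real (\<Sum>e\<in>f ` Q. 3 ^ e)" by simp
  finally have "2 * \<bar>\<Sum>x\<in>Q. \<epsilon> x * 3 ^ f x\<bar> \<le> real (2 * (\<Sum>e\<in>f ` Q. 3 ^ e))" by simp
  moreover have "2 * (\<Sum>e\<in>f ` Q. 3 ^ e) < (3::nat) ^ m"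
    using sum_powers_less[of 3 "f ` Q" m] assms(3) by auto
  then have "real (2 * (\<Sum>e\<in>f ` Q. 3 ^ e)) < 3 ^ m"
    by (metis of_nat_less_iff of_nat_numeral of_nat_power)
  ultimately show ?thesis by linarith
qed

locale heavy_digraph = acyclic_pair_digraph D for D :: "'v::linorder pair_pre_digraph" +
  fixes \<sigma> :: "'v \<times> 'v \<Rightarrow> int" and lo :: "('v \<times> 'v) rel" and T :: "'v set"
  assumes heavy: "heavy_arc_signature D \<sigma> lo" and T_subset: "T \<subseteq> pverts D"
begin

lemma \<sigma>_unit: "a \<in> A \<Longrightarrow> \<bar>\<sigma> a\<bar> = 1"
  using heavy by (auto simp: heavy_arc_signature_def)

lemma linear_lo: "linear_order_on A lo"
  using heavy by (simp add: heavy_arc_signature_def)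

lemma finite_T: "finite T"
  using T_subset finite_V finite_subset by blast

definition arc_rank :: "'v \<times> 'v \<Rightarrow> nat" where
  "arc_rank a = card {b \<in> A. (b, a) \<in> lo \<and> b \<noteq> a}"

text \<open>
  The binary number whose digits mark the arcs in \<open>P\<close>, so that comparing these numbers compares
  arc sets by the largest arc in which they differ.
\<close>
definition rank_sum :: "('v \<times> 'v) set \<Rightarrow> nat" where
  "rank_sum P = (\<Sum>a\<in>P. 2 ^ arc_rank a)"

lemma arc_rank_less:
  assumes "a \<in> A" "b \<in> A" "(a, b) \<in> lo" "a \<noteq> b"
  shows "arc_rank a < arc_rank b"
  unfolding arc_rank_def
proof (rule psubset_card_mono)
  show "finite {c \<in> A. (c, b) \<in> lo \<and> c \<noteq> b}" using finite_A by simp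
  have tr: "trans lo" and an: "antisym lo" using linear_lo
    by (auto simp: linear_order_on_def partial_order_on_def preorder_on_def)
  have "{c \<in> A. (c, a) \<in> lo \<and> c \<noteq> a} \<subseteq> {c \<in> A. (c, b) \<in> lo \<and> c \<noteq> b}"
    using tr an assms by (auto dest: transD antisymD)
  moreover have "a \<in> {c \<in> A. (c, b) \<in> lo \<and> c \<noteq> b}" "a \<notin> {c \<in> A. (c, a) \<in> lo \<and> c \<noteq> a}"
    using assms by auto
  ultimately show "{c \<in> A. (c, a) \<in> lo \<and> c \<noteq> a} \<subset> {c \<in> A. (c, b) \<in> lo \<and> c \<noteq> b}" by blast
qed

lemma lo_total:
  assumes "a \<in> A" "b \<in> A"
  shows "(a, b) \<in> lo \<or> (b, a) \<in> lo"
proof (cases "a = b")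
  case True
  have "refl_on A lo" using linear_lo by (simp add: linear_order_on_def partial_order_on_def preorder_on_def)
  then show ?thesis using True assms by (simp add: refl_onD)
next
  case False
  have "total_on A lo" using linear_lo by (simp add: linear_order_on_def)
  then show ?thesis using False assms by (simp add: total_on_def)
qed

lemma inj_arc_rank: "inj_on arc_rank A"
  using arc_rank_less lo_total by (metis inj_onI less_irrefl)

text \<open>
  The largest differing arc contributes a power of two that exceeds all smaller ones together.
\<close>
lemma rank_sum_less:
  assumes P: "P \<subseteq> A" and Q: "Q \<subseteq> A" and a: "a \<in> Q - P" and max: "\<And>b. b \<in> sym_diff P Q \<Longrightarrow> (b, a) \<in> lo"
  shows "rank_sum P < rank_sum Q"
proof -
  have fin: "finite P" "finite Q" using P Q finite_A finite_subset by blast+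
  have split: "rank_sum P = rank_sum (P \<inter> Q) + rank_sum (P - Q)" "rank_sum Q = rank_sum (P \<inter> Q) + rank_sum (Q - P)"
    unfolding rank_sum_def using fin
    by (simp_all add: sum.Int_Diff[of P _ Q] sum.Int_Diff[of Q _ P] Int_commute)
  have "rank_sum (P - Q) = (\<Sum>r\<in>arc_rank ` (P - Q). 2 ^ r)"
    unfolding rank_sum_def
    by (rule sum.reindex_cong[symmetric, OF inj_on_subset[OF inj_arc_rank]]) (use P in auto)
  also have "\<dots> < 2 ^ arc_rank a"
  proof -
    have "arc_rank b < arc_rank a" if "b \<in> P - Q" for b
      using that max[of b] a P Q by (intro arc_rank_less) auto
    then have "arc_rank ` (P - Q) \<subseteq> {..<arc_rank a}" by auto
    then show ?thesis using sum_powers_less[of 2 "arc_rank ` (P - Q)" "arc_rank a"] by simp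
  qed
  also have "\<dots> \<le> rank_sum (Q - P)"
    unfolding rank_sum_def using a fin by (intro member_le_sum) auto
  finally show ?thesis using split by simp
qed

lemma sym_diff_maximum:
  assumes "P \<subseteq> A" "Q \<subseteq> A" "P \<noteq> Q"
  shows "\<exists>a\<in>sym_diff P Q. \<forall>b\<in>sym_diff P Q. (b, a) \<in> lo"
proof -
  have sub: "sym_diff P Q \<subseteq> A" and ne: "sym_diff P Q \<noteq> {}" using assms by auto
  then have fin: "finite (sym_diff P Q)" using finite_A finite_subset by blast
  have fi: "finite (arc_rank ` sym_diff P Q)" "arc_rank ` sym_diff P Q \<noteq> {}" using fin ne by auto
  then obtain a where a: "a \<in> sym_diff P Q" "arc_rank a = Max (arc_rank ` sym_diff P Q)"
    using Max_in by (metis imageE)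
  have "(b, a) \<in> lo" if b: "b \<in> sym_diff P Q" for b
  proof -
    have le: "arc_rank b \<le> arc_rank a" using a(2) fi b by simp
    have bA: "b \<in> A" "a \<in> A" using b a sub by auto
    show ?thesis
    proof (cases "a = b")
      case True
      then show ?thesis using lo_total[OF bA] by simp
    next
      case False
      then show ?thesis using lo_total[OF bA] arc_rank_less[OF bA(2,1)] le by linarith
    qed
  qed
  then show ?thesis using a(1) by blast
qed

lemma rank_sum_less_iff:
  assumes "P \<subseteq> A" "Q \<subseteq> A"
  shows "rank_sum P < rank_sum Q \<longleftrightarrow> (\<exists>a\<in>sym_diff P Q. (\<forall>b\<in>sym_diff P Q. (b, a) \<in> lo) \<and> a \<in> Q)"
proof
  assume l: "rank_sum P < rank_sum Q"
  then have "P \<noteq> Q" by auto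
  then obtain a where a: "a \<in> sym_diff P Q" "\<And>b. b \<in> sym_diff P Q \<Longrightarrow> (b, a) \<in> lo"
    using sym_diff_maximum[OF assms] by blast
  have "a \<in> Q"
  proof (rule ccontr)
    assume "a \<notin> Q"
    then have "rank_sum Q < rank_sum P" using a by (intro rank_sum_less[OF assms(2,1)]) auto
    then show False using l by simp
  qed
  then show "\<exists>a\<in>sym_diff P Q. (\<forall>b\<in>sym_diff P Q. (b, a) \<in> lo) \<and> a \<in> Q" using a by blast
next
  assume "\<exists>a\<in>sym_diff P Q. (\<forall>b\<in>sym_diff P Q. (b, a) \<in> lo) \<and> a \<in> Q"
  then show "rank_sum P < rank_sum Q" using rank_sum_less[OF assms] by blast
qed

lemma rank_sum_inj:
  assumes "P \<subseteq> A" "Q \<subseteq> A" "rank_sum P = rank_sum Q"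
  shows "P = Q"
proof (rule ccontr)
  assume "P \<noteq> Q"
  then obtain a where a: "a \<in> sym_diff P Q" "\<And>b. b \<in> sym_diff P Q \<Longrightarrow> (b, a) \<in> lo"
    using sym_diff_maximum[OF assms(1,2)] by blast
  then have "rank_sum P < rank_sum Q \<or> rank_sum Q < rank_sum P"
    using rank_sum_less[OF assms(1,2), of a] rank_sum_less[OF assms(2,1), of a] by blast
  then show False using assms(3) by simp
qed

definition heaviest :: "'v set \<Rightarrow> 'v list set \<Rightarrow> bool" where
  "heaviest X R \<longleftrightarrow> routing D X T R \<and>
     (\<forall>Q. routing D X T Q \<longrightarrow> rank_sum (routing_arcs Q) \<le> rank_sum (routing_arcs R))"

text \<open>
  Since \<open>rank_sum\<close> represents the order on routings and is injective on arc sets, there is exactly one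
  maximal routing, namely the one of maximal \<open>rank_sum\<close>.
\<close>
lemma heaviest_max_routing:
  assumes "routing D X T R0"
  shows "heaviest X (max_routing D lo X T)"
proof -
  have bound: "rank_sum (routing_arcs R) \<le> rank_sum A" if "routing D X T R" for R
    unfolding rank_sum_def using finite_A routing_arcs_subset[OF that] by (intro sum_mono2) auto
  obtain R where R: "heaviest X R"
    unfolding heaviest_def
    using ex_has_greatest_nat[of "routing D X T" R0 "\<lambda>R. rank_sum (routing_arcs R)" "Suc (rank_sum A)"] assms bound
    by (metis less_Suc_eq_le)
  have less: "routing_less lo R Q \<longleftrightarrow> rank_sum (routing_arcs R) < rank_sum (routing_arcs Q)"
    if "routing D X T R" "routing D X T Q" for R Q
    unfolding routing_less_def
    using rank_sum_less_iff[OF routing_arcs_subset[OF that(1)] routing_arcs_subset[OF that(2)]] by blast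
  have "max_routing D lo X T = R"
    unfolding max_routing_def
  proof (rule the_equality)
    show "routing D X T R \<and> (\<nexists>Q. routing D X T Q \<and> routing_less lo R Q)"
      using R less unfolding heaviest_def by (metis not_le)
    fix Q assume Q: "routing D X T Q \<and> (\<nexists>R. routing D X T R \<and> routing_less lo Q R)"
    then have "rank_sum (routing_arcs R) = rank_sum (routing_arcs Q)"
      using R less unfolding heaviest_def by (metis le_antisym not_le)
    moreover have RQ: "routing D X T R" "routing D X T Q" using Q R by (simp_all add: heaviest_def)
    ultimately have "routing_arcs R = routing_arcs Q"
      by (intro rank_sum_inj routing_arcs_subset[OF RQ(1)] routing_arcs_subset[OF RQ(2)])
    then show "Q = R" using routing_determined_by_arcs[OF RQ] by simp
  qed
  then show ?thesis using R by simp
qed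

end

section \<open>The determinant of a linking and its dominant routing\<close>

context heavy_digraph begin

text \<open>
  The exponent \<open>2 ^ arc_rank a\<close> makes the product of the weights over \<open>P\<close> equal to \<open>3 ^ rank_sum P\<close>,
  up to sign.
\<close>
definition weight :: "'v \<times> 'v \<Rightarrow> real" where
  "weight a = of_int (\<sigma> a) * 3 ^ (2 ^ arc_rank a)"

definition arc_column :: "'v \<Rightarrow> 'v \<Rightarrow> real" where
  "arc_column v u = (if u = v then 1 else if (u, v) \<in> A then - weight (u, v) else 0)"

definition link_matrix :: "'v set \<Rightarrow> ('v \<Rightarrow> 'v) \<Rightarrow> 'v \<Rightarrow> 'v \<Rightarrow> real" where
  "link_matrix X \<tau> v = (if v \<in> X then unit_vec (\<tau> v) else arc_column v)"

definition link_det :: "'v set \<Rightarrow> ('v \<Rightarrow> 'v) \<Rightarrow> real" where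
  "link_det X \<tau> = leibniz_det V (link_matrix X \<tau>)"

lemma prod_weight: "(\<Prod>a\<in>P. weight a) = of_int (\<Prod>a\<in>P. \<sigma> a) * 3 ^ rank_sum P"
  by (simp add: weight_def prod.distrib rank_sum_def power_sum)

definition perm_sign :: "'v set \<Rightarrow> ('v \<Rightarrow> 'v) \<Rightarrow> int" where
  "perm_sign X \<pi> = sign \<pi> * (-1) ^ card (perm_arcs X \<pi>) * (\<Prod>a\<in>perm_arcs X \<pi>. \<sigma> a)"

lemma perm_arcs_subset: "\<pi> \<in> linking_perms X \<tau> \<Longrightarrow> perm_arcs X \<pi> \<subseteq> A"
  by (auto simp: perm_arcs_def linking_perms_def)

lemma abs_perm_sign:
  assumes "\<pi> \<in> linking_perms X \<tau>"
  shows "\<bar>perm_sign X \<pi>\<bar> = 1"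
proof -
  have "\<bar>\<Prod>a\<in>P. \<sigma> a\<bar> = 1" if "P \<subseteq> A" for P
    using that by (induction P rule: infinite_finite_induct) (auto simp: abs_mult \<sigma>_unit)
  then have "\<bar>\<Prod>a\<in>perm_arcs X \<pi>. \<sigma> a\<bar> = 1" using perm_arcs_subset[OF assms] .
  then show ?thesis by (simp add: perm_sign_def abs_mult power_abs)
qed

lemma finite_linking_perms: "finite (linking_perms X \<tau>)"
  by (rule finite_subset[OF _ finite_permutations[OF finite_V]]) (auto simp: linking_perms_def)

text \<open>
  The factors \<open>- 1\<close> come from the entries \<open>- weight a\<close> of \<open>I - W\<close>. Any other
  permutation meets a zero entry.
\<close>
lemma link_det_expand:
  assumes X: "X \<subseteq> V"
  shows "link_det X \<tau> = (\<Sum>\<pi>\<in>linking_perms X \<tau>. of_int (perm_sign X \<pi>) * 3 ^ rank_sum (perm_arcs X \<pi>))"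
proof -
  have "link_det X \<tau> = (\<Sum>\<pi>\<in>linking_perms X \<tau>. of_int (sign \<pi>) * (\<Prod>v\<in>V. link_matrix X \<tau> v (\<pi> v)))"
    unfolding link_det_def leibniz_det_def
  proof (rule sum.mono_neutral_right)
    show "finite {p. p permutes V}" by (rule finite_permutations[OF finite_V])
    show "linking_perms X \<tau> \<subseteq> {p. p permutes V}" by (auto simp: linking_perms_def)
    show "\<forall>\<pi>\<in>{p. p permutes V} - linking_perms X \<tau>. of_int (sign \<pi>) * (\<Prod>v\<in>V. link_matrix X \<tau> v (\<pi> v)) = 0"
    proof
      fix \<pi> assume "\<pi> \<in> {p. p permutes V} - linking_perms X \<tau>"
      then consider x where "x \<in> X" "\<pi> x \<noteq> \<tau> x" | v where "v \<in> V - X" "\<pi> v \<noteq> v" "(\<pi> v, v) \<notin> A"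
        by (auto simp: linking_perms_def)
      then have "\<exists>v\<in>V. link_matrix X \<tau> v (\<pi> v) = 0"
      proof cases
        case 1
        then show ?thesis using X by (intro bexI[of _ x]) (auto simp: link_matrix_def)
      next
        case 2
        then show ?thesis by (intro bexI[of _ v]) (auto simp: link_matrix_def arc_column_def)
      qed
      then have "(\<Prod>v\<in>V. link_matrix X \<tau> v (\<pi> v)) = 0" using finite_V by (metis prod_zero)
      then show "of_int (sign \<pi>) * (\<Prod>v\<in>V. link_matrix X \<tau> v (\<pi> v)) = 0" by simp
    qed
  qed
  also have "\<dots> = (\<Sum>\<pi>\<in>linking_perms X \<tau>. of_int (perm_sign X \<pi>) * 3 ^ rank_sum (perm_arcs X \<pi>))"
  proof (rule sum.cong[OF refl])
    fix \<pi> assume \<pi>: "\<pi> \<in> linking_perms X \<tau>"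
    let ?M = "{v \<in> V - X. \<pi> v \<noteq> v}"
    have "(\<Prod>v\<in>V. link_matrix X \<tau> v (\<pi> v)) = (\<Prod>v\<in>?M. link_matrix X \<tau> v (\<pi> v))"
      by (rule prod.mono_neutral_right)
        (use finite_V \<pi> in \<open>auto simp: linking_perms_def link_matrix_def arc_column_def\<close>)
    also have "\<dots> = (\<Prod>v\<in>?M. - weight (\<pi> v, v))"
      by (rule prod.cong[OF refl])
        (use \<pi> in \<open>auto simp: linking_perms_def link_matrix_def arc_column_def\<close>)
    also have "\<dots> = (\<Prod>a\<in>perm_arcs X \<pi>. - weight a)"
      unfolding perm_arcs_def by (subst prod.reindex) (auto simp: inj_on_def)
    also have "\<dots> = (-1) ^ card (perm_arcs X \<pi>) * (\<Prod>a\<in>perm_arcs X \<pi>. weight a)"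
      by (simp add: prod_uminus)
    finally show "of_int (sign \<pi>) * (\<Prod>v\<in>V. link_matrix X \<tau> v (\<pi> v))
        = of_int (perm_sign X \<pi>) * 3 ^ rank_sum (perm_arcs X \<pi>)"
      using prod_weight[of "perm_arcs X \<pi>"] by (simp add: perm_sign_def)
  qed
  finally show ?thesis .
qed

lemma rank_sum_inj_perms: "inj_on (\<lambda>\<pi>. rank_sum (perm_arcs X \<pi>)) (linking_perms X \<tau>)"
proof (rule inj_onI)
  fix \<pi> \<rho> assume *: "\<pi> \<in> linking_perms X \<tau>" "\<rho> \<in> linking_perms X \<tau>"
    "rank_sum (perm_arcs X \<pi>) = rank_sum (perm_arcs X \<rho>)"
  then have "perm_arcs X \<pi> = perm_arcs X \<rho>" by (intro rank_sum_inj perm_arcs_subset)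
  then show "\<pi> = \<rho>" using linking_perm_determined_by_arcs[OF *(1,2)] by simp
qed

lemma routing_of_link_det:
  assumes "X \<subseteq> V" "link_det X \<tau> \<noteq> 0"
  shows "\<exists>R. routing D X (\<tau> ` X) R"
proof -
  have "linking_perms X \<tau> \<noteq> {}" using assms link_det_expand by fastforce
  then show ?thesis using routing_of_linking_perm assms(1) by blast
qed

lemma perm_le_heaviest:
  assumes "X \<subseteq> V" "heaviest X R" "\<tau> ` X \<subseteq> T" "\<pi> \<in> linking_perms X \<tau>"
  shows "rank_sum (perm_arcs X \<pi>) \<le> rank_sum (routing_arcs R)"
proof -
  obtain Q where Q: "routing D X (\<tau> ` X) Q" "routing_arcs Q = perm_arcs X \<pi>"
    using routing_of_linking_perm[OF assms(4,1)] by blast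
  then show ?thesis using assms(2) routing_mono[OF Q(1) assms(3)] by (metis heaviest_def)
qed

text \<open>
  None of the routings onto \<open>\<tau> ` X\<close> is the heaviest one, as that one ends elsewhere; so all exponents
  are strictly smaller.
\<close>
lemma link_det_small:
  assumes X: "X \<subseteq> V" and R: "heaviest X R" and \<tau>: "inj_on \<tau> X" "\<tau> ` X \<subseteq> T" "\<tau> ` X \<noteq> last ` R"
  shows "2 * \<bar>link_det X \<tau>\<bar> < 3 ^ rank_sum (routing_arcs R)"
  unfolding link_det_expand[OF X]
proof (rule dominated_sum[OF finite_linking_perms rank_sum_inj_perms])
  fix \<pi> assume \<pi>: "\<pi> \<in> linking_perms X \<tau>"
  show "\<bar>real_of_int (perm_sign X \<pi>)\<bar> = 1" using abs_perm_sign[OF \<pi>] by linarith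
  have RT: "routing D X T R" using R by (simp add: heaviest_def)
  obtain Q where Q: "routing D X (\<tau> ` X) Q" "routing_arcs Q = perm_arcs X \<pi>"
    using routing_of_linking_perm[OF \<pi> X] by blast
  have finX: "finite X" using X finite_V finite_subset by blast
  have "rank_sum (perm_arcs X \<pi>) \<noteq> rank_sum (routing_arcs R)"
  proof
    assume "rank_sum (perm_arcs X \<pi>) = rank_sum (routing_arcs R)"
    then have "routing_arcs Q = routing_arcs R"
      using rank_sum_inj perm_arcs_subset[OF \<pi>] routing_arcs_subset[OF RT] Q(2) by simp
    then have "Q = R" using routing_determined_by_arcs[OF Q(1) RT] by blast
    then have "last ` R \<subseteq> \<tau> ` X" "card (last ` R) = card (\<tau> ` X)"
      using routing_card_ends[OF Q(1)] card_image[OF \<tau>(1)] by auto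
    then show False using \<tau>(3) finX by (metis card_subset_eq finite_imageI)
  qed
  then show "rank_sum (perm_arcs X \<pi>) < rank_sum (routing_arcs R)"
    using perm_le_heaviest[OF X R \<tau>(2) \<pi>] by simp
qed

lemma routing_sign_eq:
  assumes X: "X \<subseteq> V" and R: "routing D X T R" and \<chi>: "\<chi> permutes X" and \<tau>: "strict_mono_on X \<tau>"
    and ends: "\<And>p. p \<in> R \<Longrightarrow> \<tau> (\<chi> (hd p)) = last p"
  shows "routing_sign \<sigma> X T R = sign \<chi> * (\<Prod>a\<in>routing_arcs R. \<sigma> a)"
proof -
  have finX: "finite X" using X finite_V finite_subset by blast
  have "map_sign (card X) (routing_map X T R) = sign \<chi>"
    by (rule map_sign_eq_sign[OF finX finite_T \<chi> \<tau> routing_inj_hd[OF R] routing_hd_image[OF R]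
          routing_card_ends(2)[OF R] ends])
  moreover have "(\<Prod>p\<in>R. \<Prod>a\<in>set (vwalk_arcs p). \<sigma> a) = (\<Prod>a\<in>routing_arcs R. \<sigma> a)"
    unfolding routing_arcs_def
  proof (rule prod.UNION_disjoint[symmetric])
    show "finite R" by (rule routing_finite[OF R finX])
    show "\<forall>p\<in>R. \<forall>q\<in>R. p \<noteq> q \<longrightarrow> set (vwalk_arcs p) \<inter> set (vwalk_arcs q) = {}"
    proof (intro ballI impI, rule ccontr)
      fix p q assume pq: "p \<in> R" "q \<in> R" "p \<noteq> q" "set (vwalk_arcs p) \<inter> set (vwalk_arcs q) \<noteq> {}"
      then obtain u v where "(u, v) \<in> set (vwalk_arcs p)" "(u, v) \<in> set (vwalk_arcs q)" by auto
      then show False using routingD(3)[OF R pq(1,2), of u] pq(3) vwalk_arcs_in_set by fast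
    qed
  qed simp
  ultimately show ?thesis by (simp add: routing_sign_def)
qed

text \<open>
  The term of the permutation belonging to \<open>R\<close> is compared with the sum of all others.
\<close>
lemma link_det_dominant:
  assumes X: "X \<subseteq> V" and R: "heaviest X R" and \<tau>: "bij_betw \<tau> X (last ` R)"
  shows "\<exists>\<epsilon>::int. \<bar>\<epsilon>\<bar> = 1 \<and> 2 * \<bar>link_det X \<tau> - of_int \<epsilon> * 3 ^ rank_sum (routing_arcs R)\<bar> < 3 ^ rank_sum (routing_arcs R)
     \<and> (strict_mono_on X \<tau> \<longrightarrow> \<epsilon> = routing_sign \<sigma> X T R)"
proof -
  let ?L = "linking_perms X \<tau>" and ?m = "rank_sum (routing_arcs R)"
  have RT: "routing D X T R" using R by (simp add: heaviest_def)
  obtain \<pi> \<chi> where \<pi>: "\<pi> \<in> ?L" "perm_arcs X \<pi> = routing_arcs R"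
    and \<chi>: "\<chi> permutes X" "\<And>p. p \<in> R \<Longrightarrow> \<tau> (\<chi> (hd p)) = last p" "sign \<pi> * (-1) ^ card (routing_arcs R) = sign \<chi>"
    using linking_perm_of_routing[OF RT X \<tau>] by blast
  have \<tau>T: "\<tau> ` X \<subseteq> T" using \<tau> routing_card_ends(2)[OF RT] by (simp add: bij_betw_def)
  let ?f = "\<lambda>\<rho>. of_int (perm_sign X \<rho>) * 3 ^ rank_sum (perm_arcs X \<rho>) :: real"
  have "link_det X \<tau> = ?f \<pi> + (\<Sum>\<rho>\<in>?L - {\<pi>}. ?f \<rho>)"
    unfolding link_det_expand[OF X] by (rule sum.remove[OF finite_linking_perms \<pi>(1)])
  then have diff: "link_det X \<tau> - of_int (perm_sign X \<pi>) * 3 ^ ?m = (\<Sum>\<rho>\<in>?L - {\<pi>}. ?f \<rho>)"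
    using \<pi>(2) by simp
  have "2 * \<bar>\<Sum>\<rho>\<in>?L - {\<pi>}. ?f \<rho>\<bar> < 3 ^ ?m"
  proof (rule dominated_sum)
    show "finite (?L - {\<pi>})" using finite_linking_perms by simp
    show "inj_on (\<lambda>\<pi>. rank_sum (perm_arcs X \<pi>)) (?L - {\<pi>})"
      using rank_sum_inj_perms by (rule inj_on_subset) auto
    fix \<rho> assume \<rho>: "\<rho> \<in> ?L - {\<pi>}"
    then show "\<bar>real_of_int (perm_sign X \<rho>)\<bar> = 1" using abs_perm_sign[of \<rho> X \<tau>] by simp
    have "rank_sum (perm_arcs X \<rho>) \<noteq> ?m"
      using inj_onD[OF rank_sum_inj_perms, of X \<rho> \<pi> \<tau>] \<rho> \<pi> by auto
    then show "rank_sum (perm_arcs X \<rho>) < ?m" using perm_le_heaviest[OF X R \<tau>T, of \<rho>] \<rho> by simp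
  qed
  moreover have "perm_sign X \<pi> = routing_sign \<sigma> X T R" if "strict_mono_on X \<tau>"
    using routing_sign_eq[OF X RT \<chi>(1) that \<chi>(2)] \<chi>(3) by (simp add: perm_sign_def \<pi>(2))
  ultimately show ?thesis using abs_perm_sign[OF \<pi>(1)] diff by metis
qed

end

section \<open>The gammoid as a matroid of linear dependencies\<close>

context heavy_digraph begin

text \<open>
  The linear relations between the vectors of weighted path sums from the elements of \<open>E\<close> to \<open>T\<close>,
  written as \<open>z\<^sup>T (I - W)\<close> to avoid summing over paths.
\<close>
definition dependencies :: "'v set \<Rightarrow> ('v \<Rightarrow> real) set" where
  "dependencies E = {x. vsupp x \<subseteq> E \<and>
     (\<exists>z. (\<forall>t\<in>T. z t = 0) \<and> (\<forall>v\<in>V. x v = (\<Sum>u\<in>V. z u * arc_column v u)))}"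

lemma dependenciesI:
  assumes "vsupp x \<subseteq> E" "\<And>t. t \<in> T \<Longrightarrow> z t = 0" "\<And>v. v \<in> V \<Longrightarrow> x v = (\<Sum>u\<in>V. z u * arc_column v u)"
  shows "x \<in> dependencies E"
  unfolding dependencies_def mem_Collect_eq using assms by (intro conjI exI[of _ z]) auto

lemma dependenciesE:
  assumes "x \<in> dependencies E"
  obtains z where "\<And>t. t \<in> T \<Longrightarrow> z t = 0" "\<And>v. v \<in> V \<Longrightarrow> x v = (\<Sum>u\<in>V. z u * arc_column v u)"
    "\<And>v. v \<in> V \<Longrightarrow> x v \<noteq> 0 \<Longrightarrow> \<exists>u\<in>V. z u \<noteq> 0"
proof -
  obtain z where z: "\<And>t. t \<in> T \<Longrightarrow> z t = 0" "\<And>v. v \<in> V \<Longrightarrow> x v = (\<Sum>u\<in>V. z u * arc_column v u)"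
    using assms unfolding dependencies_def by blast
  have "\<exists>u\<in>V. z u \<noteq> 0" if v: "v \<in> V" "x v \<noteq> 0" for v
  proof (rule ccontr)
    assume "\<not> ?thesis"
    then have "(\<Sum>u\<in>V. z u * arc_column v u) = 0" by (intro sum.neutral) auto
    then show False using z(2)[OF v(1)] v(2) by simp
  qed
  then show ?thesis using that z by blast
qed

lemma dependencies_subspace:
  assumes "E \<subseteq> V"
  shows "coordinate_subspace E (dependencies E)"
proof
  show "finite E" using assms finite_V finite_subset by blast
  show "vsupp x \<subseteq> E" if "x \<in> dependencies E" for x using that by (simp add: dependencies_def)
  show "(\<lambda>_. 0) \<in> dependencies E"
    unfolding dependencies_def by (auto simp: vsupp_def intro!: exI[of _ "\<lambda>_. 0"])
  fix x y :: "'v \<Rightarrow> real" and a b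
  assume "x \<in> dependencies E" "y \<in> dependencies E"
  then obtain z w where z: "vsupp x \<subseteq> E" "\<And>t. t \<in> T \<Longrightarrow> z t = 0" "\<And>v. v \<in> V \<Longrightarrow> x v = (\<Sum>u\<in>V. z u * arc_column v u)"
    and w: "vsupp y \<subseteq> E" "\<And>t. t \<in> T \<Longrightarrow> w t = 0" "\<And>v. v \<in> V \<Longrightarrow> y v = (\<Sum>u\<in>V. w u * arc_column v u)"
    unfolding dependencies_def by blast
  have "vsupp (\<lambda>e. a * x e + b * y e) \<subseteq> vsupp x \<union> vsupp y" by (auto simp: vsupp_def)
  then have "vsupp (\<lambda>e. a * x e + b * y e) \<subseteq> E" using z(1) w(1) by blast
  moreover have "a * x v + b * y v = (\<Sum>u\<in>V. (a * z u + b * w u) * arc_column v u)" if "v \<in> V" for v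
    unfolding z(3)[OF that] w(3)[OF that]
    by (simp add: sum_distrib_left sum.distrib algebra_simps)
  moreover have "a * z t + b * w t = 0" if "t \<in> T" for t using z(2) w(2) that by simp
  ultimately show "(\<lambda>e. a * x e + b * y e) \<in> dependencies E"
    by (intro dependenciesI[where z = "\<lambda>u. a * z u + b * w u"]) auto
qed

lemma heaviest_link_det_bound:
  assumes X: "X \<subseteq> V" and R: "heaviest X R" and \<tau>: "bij_betw \<tau> X (last ` R)"
  shows "3 ^ rank_sum (routing_arcs R) < 2 * \<bar>link_det X \<tau>\<bar>"
proof -
  obtain \<epsilon> :: int where \<epsilon>: "\<bar>\<epsilon>\<bar> = 1"
    "2 * \<bar>link_det X \<tau> - of_int \<epsilon> * 3 ^ rank_sum (routing_arcs R)\<bar> < 3 ^ rank_sum (routing_arcs R)"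
    using link_det_dominant[OF assms] by blast
  then have "\<epsilon> = 1 \<or> \<epsilon> = -1" by linarith
  then show ?thesis using \<epsilon>(2) by (auto simp: abs_if split: if_splits)
qed

lemma heaviest_link_det_sign:
  assumes X: "X \<subseteq> V" and R: "heaviest X R" and \<tau>: "bij_betw \<tau> X (last ` R)" "strict_mono_on X \<tau>"
  shows "routing_sign \<sigma> X T R \<in> {-1, 1}" "link_det X \<tau> \<noteq> 0"
    "link_det X \<tau> > 0 \<longleftrightarrow> routing_sign \<sigma> X T R = 1"
proof -
  obtain \<epsilon> :: int where \<epsilon>: "\<bar>\<epsilon>\<bar> = 1"
    "2 * \<bar>link_det X \<tau> - of_int \<epsilon> * 3 ^ rank_sum (routing_arcs R)\<bar> < 3 ^ rank_sum (routing_arcs R)"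
    "\<epsilon> = routing_sign \<sigma> X T R"
    using link_det_dominant[OF X R \<tau>(1)] \<tau>(2) by blast
  have pos: "(0::real) < 3 ^ rank_sum (routing_arcs R)" by simp
  have c: "\<epsilon> = 1 \<or> \<epsilon> = -1" using \<epsilon>(1) by linarith
  then show "routing_sign \<sigma> X T R \<in> {-1, 1}" using \<epsilon>(3) by auto
  from c show "link_det X \<tau> \<noteq> 0" using \<epsilon>(2) pos by auto
  from c show "link_det X \<tau> > 0 \<longleftrightarrow> routing_sign \<sigma> X T R = 1"
    unfolding \<epsilon>(3)[symmetric] using \<epsilon>(2) pos by (elim disjE) (auto simp: abs_if split: if_splits)
qed

lemma heaviest_ends_bij:
  assumes "X \<subseteq> V" "heaviest X R"
  shows "\<exists>\<tau>. bij_betw \<tau> X (last ` R) \<and> strict_mono_on X \<tau>" "last ` R \<subseteq> T"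
proof -
  have R: "routing D X T R" using assms(2) by (simp add: heaviest_def)
  have "finite X" using assms(1) finite_V finite_subset by blast
  then show "\<exists>\<tau>. bij_betw \<tau> X (last ` R) \<and> strict_mono_on X \<tau>"
    using routing_card_ends[OF R] finite_T by (intro ex_strict_mono_bij) (auto intro: finite_subset)
  show "last ` R \<subseteq> T" by (rule routing_card_ends(2)[OF R])
qed

text \<open>
  If the dependency is \<open>z\<^sup>T (I - W)\<close>, then \<open>z\<close> annihilates all columns of the matrix for
  an injection \<open>\<tau> : X \<rightarrow> T\<close>: outside \<open>X\<close> because the dependency vanishes there, and on \<open>X\<close> because \<open>z\<close> vanishes on \<open>T\<close>. But
  the determinant for the ends of the heaviest routing is nonzero.
\<close>
lemma routable_no_dependency:
  assumes X: "X \<subseteq> V" and R0: "routing D X T R0" and x: "x \<in> dependencies V" "vsupp x \<subseteq> X"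
  shows "vsupp x = {}"
proof (rule ccontr)
  assume ne: "vsupp x \<noteq> {}"
  have R: "heaviest X (max_routing D lo X T)" by (rule heaviest_max_routing[OF R0])
  obtain \<tau> where \<tau>: "bij_betw \<tau> X (last ` max_routing D lo X T)" "strict_mono_on X \<tau>"
    using heaviest_ends_bij(1)[OF X R] by blast
  have \<tau>T: "\<tau> v \<in> T" if "v \<in> X" for v using \<tau>(1) heaviest_ends_bij(2)[OF X R] that bij_betwE by blast
  obtain z where z: "\<And>t. t \<in> T \<Longrightarrow> z t = 0" "\<And>v. v \<in> V \<Longrightarrow> x v = (\<Sum>u\<in>V. z u * arc_column v u)"
    and ne0: "\<And>v. v \<in> V \<Longrightarrow> x v \<noteq> 0 \<Longrightarrow> \<exists>u\<in>V. z u \<noteq> 0"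
    using dependenciesE[OF x(1)] by blast
  obtain v where v: "x v \<noteq> 0" "v \<in> V" using ne x X by (auto simp: vsupp_def)
  then obtain u where u: "u \<in> V" "z u \<noteq> 0" using ne0[OF v(2,1)] by blast
  have "link_det X \<tau> = 0"
    unfolding link_det_def
  proof (rule leibniz_det_annihilated[where z = z, OF finite_V u])
    fix v assume v: "v \<in> V"
    show "(\<Sum>w\<in>V. z w * link_matrix X \<tau> v w) = 0"
    proof (cases "v \<in> X")
      case True
      have "(\<Sum>w\<in>V. z w * link_matrix X \<tau> v w) = (\<Sum>w\<in>V. 0)"
        by (rule sum.cong[OF refl]) (use True z(1)[OF \<tau>T[OF True]] in \<open>auto simp: link_matrix_def\<close>)
      then show ?thesis by simp
    next
      case False
      then have "x v = 0" using x(2) by (auto simp: vsupp_def)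
      then show ?thesis using False z(2)[OF v] by (simp add: link_matrix_def)
    qed
  qed
  then show False using heaviest_link_det_sign(2)[OF X R \<tau>] by simp
qed

text \<open>
  Cramer's rule produces \<open>z\<close> with \<open>z\<^sup>T M\<close> a multiple of the unit vector at \<open>c\<close>, where \<open>M\<close> is a nonsingular
  matrix for \<open>C - {c}\<close>. Its entry at \<open>t \<in> T\<close> is a determinant for all of \<open>C\<close>, with
  \<open>c\<close> linked to \<open>t\<close>, and vanishes because \<open>C\<close> has no routing.
\<close>
lemma dependency_of_unroutable:
  assumes C: "C \<subseteq> V" and no: "\<nexists>R. routing D C T R" and c: "c \<in> C" and R0: "routing D (C - {c}) T R0"
  shows "\<exists>x\<in>dependencies C. x c \<noteq> 0"
proof -
  let ?X = "C - {c}" and ?R = "max_routing D lo (C - {c}) T"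
  have X: "?X \<subseteq> V" and cV: "c \<in> V" using C c by auto
  have R: "heaviest ?X ?R" by (rule heaviest_max_routing[OF R0])
  obtain \<tau> where \<tau>: "bij_betw \<tau> ?X (last ` ?R)" "strict_mono_on ?X \<tau>"
    using heaviest_ends_bij(1)[OF X R] by blast
  have \<tau>T: "\<tau> ` ?X \<subseteq> T" using \<tau>(1) heaviest_ends_bij(2)[OF X R] by (simp add: bij_betw_def)
  define M where "M = link_matrix ?X \<tau>"
  define z where "z = (\<lambda>u. leibniz_det V (M(c := unit_vec u)))"
  define x where "x = (\<lambda>v. if v \<in> V then (\<Sum>u\<in>V. z u * arc_column v u) else 0)"
  have zM: "(\<Sum>u\<in>V. z u * M v u) = (if v = c then leibniz_det V M else 0)" if "v \<in> V" for v
    unfolding z_def by (rule leibniz_det_cramer[OF finite_V cV that])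
  have zT: "z t = 0" if t: "t \<in> T" for t
  proof (rule ccontr)
    assume "z t \<noteq> 0"
    moreover have "M(c := unit_vec t) = link_matrix C (\<tau>(c := t))"
      using c by (auto simp: M_def link_matrix_def fun_eq_iff)
    ultimately have "link_det C (\<tau>(c := t)) \<noteq> 0" by (simp add: z_def link_det_def)
    then obtain Q where Q: "routing D C ((\<tau>(c := t)) ` C) Q" using routing_of_link_det[OF C] by blast
    have "(\<tau>(c := t)) ` C \<subseteq> T" using \<tau>T t by auto
    then show False using no routing_mono[OF Q] by blast
  qed
  have "x c = leibniz_det V M"
    using zM[OF cV] cV by (simp add: x_def M_def link_matrix_def)
  then have xc: "x c \<noteq> 0" using heaviest_link_det_sign(2)[OF X R \<tau>] by (simp add: M_def link_det_def)
  have "x v = 0" if "v \<notin> C" for v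
  proof (cases "v \<in> V")
    case True
    then show ?thesis using zM[OF True] that c by (auto simp: x_def M_def link_matrix_def)
  qed (simp add: x_def)
  then have "vsupp x \<subseteq> C" by (auto simp: vsupp_def)
  moreover have "\<forall>v\<in>V. x v = (\<Sum>u\<in>V. z u * arc_column v u)" by (simp add: x_def)
  ultimately have "x \<in> dependencies C" using zT by (intro dependenciesI[where z = z]) auto
  then show ?thesis using xc by blast
qed

lemma dependencies_mono: "X \<subseteq> Y \<Longrightarrow> dependencies X \<subseteq> dependencies Y"
  unfolding dependencies_def by blast

text \<open>
  A set without a routing contains a minimal one, and removing any element of that one leaves a routable set.
\<close>
lemma gammoid_indeps:
  assumes E: "E \<subseteq> V"
  shows "indeps (gammoid D T E) = free_sets E (dependencies E)"
proof (intro set_eqI iffI)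
  fix X assume "X \<in> indeps (gammoid D T E)"
  then obtain R where "X \<subseteq> E" "routing D X T R" by (auto simp: gammoid_def)
  then show "X \<in> free_sets E (dependencies E)"
    unfolding free_sets_def using routable_no_dependency[of X R] dependencies_mono[OF E] E by blast
next
  fix X assume X: "X \<in> free_sets E (dependencies E)"
  then have XE: "X \<subseteq> E" by (simp add: free_sets_def)
  have "\<exists>R. routing D X T R"
  proof (rule ccontr)
    assume no: "\<nexists>R. routing D X T R"
    define \<N> where "\<N> = {C. C \<subseteq> X \<and> (\<nexists>R. routing D C T R)}"
    have "finite X" using finite_subset[OF subset_trans[OF XE E] finite_V] .
    moreover have "\<N> \<subseteq> Pow X" by (auto simp: \<N>_def)
    ultimately have "finite \<N>" by (auto intro: finite_subset)
    moreover have "X \<in> \<N>" using no by (simp add: \<N>_def)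
    ultimately obtain C where C: "C \<in> \<N>" "\<And>B. B \<in> \<N> \<Longrightarrow> B \<subseteq> C \<Longrightarrow> B = C"
      using finite_has_minimal2[of \<N> X] by blast
    have noC: "\<nexists>R. routing D C T R" and CX: "C \<subseteq> X" using C(1) by (auto simp: \<N>_def)
    have "routing D {} T {}" by (simp add: routing_def)
    then have "C \<noteq> {}" using noC by auto
    then obtain c where c: "c \<in> C" by blast
    have "C - {c} \<notin> \<N>" using C(2)[of "C - {c}"] c by blast
    then obtain R0 where R0: "routing D (C - {c}) T R0" using CX by (auto simp: \<N>_def)
    obtain x where x: "x \<in> dependencies C" "x c \<noteq> 0"
      using dependency_of_unroutable[OF _ noC c R0] CX XE E by blast
    then have "x \<in> dependencies E" "vsupp x \<subseteq> X" using dependencies_mono[of C E] CX XE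
      by (auto simp: dependencies_def)
    then have "vsupp x = {}" using X by (auto simp: free_sets_def)
    then show False using x(2) by (auto simp: vsupp_def)
  qed
  then show "X \<in> indeps (gammoid D T E)" using XE by (simp add: gammoid_def)
qed

end

section \<open>Signs along a circuit\<close>

context heavy_digraph begin

text \<open>
  Both matrices arise from the one with only \<open>C - {j, k}\<close> replaced, by putting the unit vector at
  \<open>\<tau> j\<close> into column \<open>j\<close> or into column \<open>k\<close>. The row vector \<open>z\<close> of the dependency annihilates all other columns and
  takes the values \<open>x j\<close> and \<open>x k\<close> on the original columns \<open>j\<close> and \<open>k\<close>.
\<close>
lemma link_det_exchange:
  assumes C: "C \<subseteq> V" and x: "x \<in> dependencies V" "vsupp x = C" and jk: "j \<in> C" "k \<in> C" "j \<noteq> k"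
    and \<tau>: "\<tau> ` (C - {k}) \<subseteq> T"
  shows "x j * link_det (C - {k}) \<tau> = - (x k * link_det (C - {j}) (\<tau> \<circ> transpose j k))"
proof -
  obtain z where z: "\<And>t. t \<in> T \<Longrightarrow> z t = 0" "\<And>v. v \<in> V \<Longrightarrow> x v = (\<Sum>u\<in>V. z u * arc_column v u)"
    and ne0: "\<And>v. v \<in> V \<Longrightarrow> x v \<noteq> 0 \<Longrightarrow> \<exists>u\<in>V. z u \<noteq> 0"
    using dependenciesE[OF x(1)] by blast
  have jV: "j \<in> V" "k \<in> V" using jk C by auto
  have "x j \<noteq> 0" using x(2) jk by (auto simp: vsupp_def)
  then obtain u where u: "u \<in> V" "z u \<noteq> 0" using ne0[OF jV(1)] by blast
  let ?A = "link_matrix (C - {j, k}) \<tau>" and ?t = "unit_vec (\<tau> j)"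
  have unit0: "(\<Sum>w\<in>V. z w * unit_vec (\<tau> v) w) = 0" if "v \<in> C - {k}" for v
  proof -
    have "z (\<tau> v) = 0" using \<tau> z(1) that by blast
    then have "(\<Sum>w\<in>V. z w * unit_vec (\<tau> v) w) = (\<Sum>w\<in>V. 0)" by (intro sum.cong) auto
    then show ?thesis by simp
  qed
  have null: "(\<Sum>w\<in>V. z w * ?A v w) = 0" if v: "v \<in> V - {j, k}" for v
  proof (cases "v \<in> C")
    case True
    then show ?thesis using unit0[of v] v by (simp add: link_matrix_def)
  next
    case False
    then have "x v = 0" using x(2) by (auto simp: vsupp_def)
    then show ?thesis using False z(2)[of v] v by (simp add: link_matrix_def)
  qed
  have ex: "(\<Sum>w\<in>V. z w * ?A k w) * leibniz_det V (?A(k := ?t)) = - (\<Sum>w\<in>V. z w * ?A j w) * leibniz_det V (?A(j := ?t))"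
    by (rule leibniz_det_exchange[OF finite_V jV jk(3) u null]) (use unit0[of j] jk in auto)
  have "(\<Sum>w\<in>V. z w * ?A k w) = x k" "(\<Sum>w\<in>V. z w * ?A j w) = x j"
    using z(2) jV by (simp_all add: link_matrix_def)
  moreover have "?A(j := ?t) = link_matrix (C - {k}) \<tau>"
    using jk by (auto simp: link_matrix_def fun_eq_iff)
  moreover have "?A(k := ?t) = link_matrix (C - {j}) (\<tau> \<circ> transpose j k)"
    using jk by (auto simp: link_matrix_def fun_eq_iff transpose_def)
  ultimately show ?thesis using ex by (simp add: link_det_def)
qed

lemma bij_betw_transpose_diff:
  assumes "j \<in> C" "k \<in> C"
  shows "bij_betw (transpose j k) (C - {j}) (C - {k})"
  by (rule bij_betw_byWitness[of _ "transpose j k"]) (use assms in \<open>auto simp: transpose_def\<close>)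

text \<open>
  Suppose the ends differ. Choose \<open>\<tau>\<close> onto the ends of \<open>Rk\<close>: the determinant for \<open>C - {k}\<close> is large and
  the one for \<open>C - {j}\<close> is small, so the exchange relation bounds \<open>\<bar>x j\<bar>\<close> by
  \<open>\<bar>x k\<bar>\<close> times a quotient of powers of three. With the roles of \<open>j\<close> and \<open>k\<close> exchanged the opposite inequality follows.
\<close>
lemma circuit_ends_agree:
  assumes C: "C \<subseteq> V" and x: "x \<in> dependencies V" "vsupp x = C" and jk: "j \<in> C" "k \<in> C" "j \<noteq> k"
    and Rj: "heaviest (C - {j}) Rj" and Rk: "heaviest (C - {k}) Rk"
  shows "last ` Rj = last ` Rk"
proof (rule ccontr)
  assume ne: "last ` Rj \<noteq> last ` Rk"
  have less: "\<bar>x j\<bar> * 3 ^ rank_sum (routing_arcs Rk) < \<bar>x k\<bar> * 3 ^ rank_sum (routing_arcs Rj)"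
    if jk: "j \<in> C" "k \<in> C" "j \<noteq> k"
      and Rj: "heaviest (C - {j}) Rj" and Rk: "heaviest (C - {k}) Rk" and ne: "last ` Rj \<noteq> last ` Rk"
    for j k Rj Rk
  proof -
    have Cj: "C - {j} \<subseteq> V" and Ck: "C - {k} \<subseteq> V" using C by auto
    obtain \<tau> where \<tau>: "bij_betw \<tau> (C - {k}) (last ` Rk)" using heaviest_ends_bij(1)[OF Ck Rk] by blast
    have \<tau>': "bij_betw (\<tau> \<circ> transpose j k) (C - {j}) (last ` Rk)"
      using bij_betw_trans[OF bij_betw_transpose_diff[OF jk(1,2)] \<tau>] .
    have T': "last ` Rk \<subseteq> T" by (rule heaviest_ends_bij(2)[OF Ck Rk])
    have big: "3 ^ rank_sum (routing_arcs Rk) < 2 * \<bar>link_det (C - {k}) \<tau>\<bar>"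
      by (rule heaviest_link_det_bound[OF Ck Rk \<tau>])
    have small: "2 * \<bar>link_det (C - {j}) (\<tau> \<circ> transpose j k)\<bar> < 3 ^ rank_sum (routing_arcs Rj)"
      by (rule link_det_small[OF Cj Rj]) (use \<tau>' T' ne in \<open>auto simp: bij_betw_def\<close>)
    have "x j * link_det (C - {k}) \<tau> = - (x k * link_det (C - {j}) (\<tau> \<circ> transpose j k))"
      by (rule link_det_exchange[OF C x jk]) (use \<tau> T' in \<open>auto simp: bij_betw_def\<close>)
    then have eq: "\<bar>x j\<bar> * \<bar>link_det (C - {k}) \<tau>\<bar> = \<bar>x k\<bar> * \<bar>link_det (C - {j}) (\<tau> \<circ> transpose j k)\<bar>"
      by (metis abs_minus_cancel abs_mult)
    have pos: "\<bar>x j\<bar> > 0" "\<bar>x k\<bar> > 0" using x(2) jk by (auto simp: vsupp_def)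
    have "\<bar>x j\<bar> * 3 ^ rank_sum (routing_arcs Rk) < \<bar>x j\<bar> * (2 * \<bar>link_det (C - {k}) \<tau>\<bar>)"
      by (rule mult_strict_left_mono[OF big pos(1)])
    also have "\<dots> = \<bar>x k\<bar> * (2 * \<bar>link_det (C - {j}) (\<tau> \<circ> transpose j k)\<bar>)" using eq by linarith
    also have "\<dots> < \<bar>x k\<bar> * 3 ^ rank_sum (routing_arcs Rj)"
      by (rule mult_strict_left_mono[OF small pos(2)])
    finally show ?thesis .
  qed
  from less[OF jk Rj Rk ne] less[OF jk(2,1) jk(3)[symmetric] Rk Rj ne[symmetric]] show False by simp
qed

text \<open>
  By equality of the ends, one and the same bijection \<open>\<tau>\<close>, up to exchanging \<open>j\<close> and \<open>k\<close>, shows the sign of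
  both maximal routings, and the exchange relation supplies the minus sign.
\<close>
lemma adjacent_signs:
  assumes C: "C \<subseteq> V" and x: "x \<in> dependencies V" "vsupp x = C" and jk: "j \<in> C" "k \<in> C" "j < k"
    and adj: "\<And>a. a \<in> C \<Longrightarrow> a < k \<Longrightarrow> a \<le> j"
    and Rj: "heaviest (C - {j}) Rj" and Rk: "heaviest (C - {k}) Rk"
  shows "sign_vec x j * routing_sign \<sigma> (C - {k}) T Rk = - (sign_vec x k * routing_sign \<sigma> (C - {j}) T Rj)"
proof -
  have Cj: "C - {j} \<subseteq> V" and Ck: "C - {k} \<subseteq> V" using C by auto
  have S: "last ` Rj = last ` Rk"
    using circuit_ends_agree[OF C x jk(1,2) _ Rj Rk] jk(3) by simp
  obtain \<tau> where \<tau>: "bij_betw \<tau> (C - {k}) (last ` Rk)" "strict_mono_on (C - {k}) \<tau>"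
    using heaviest_ends_bij(1)[OF Ck Rk] by blast
  let ?\<tau>' = "\<tau> \<circ> transpose j k"
  have \<tau>': "bij_betw ?\<tau>' (C - {j}) (last ` Rj)"
    unfolding S using bij_betw_trans[OF bij_betw_transpose_diff[OF jk(1,2)] \<tau>(1)] .
  \<comment> \<open>k takes the place of j, and no element of C lies between\<close>
  have mono': "strict_mono_on (C - {j}) ?\<tau>'"
  proof (rule strict_mono_onI)
    fix a b assume ab: "a \<in> C - {j}" "b \<in> C - {j}" "a < b"
    have "transpose j k a < transpose j k b"
      using ab jk adj[of a] by (auto simp: transpose_def)
    moreover have "transpose j k a \<in> C - {k}" "transpose j k b \<in> C - {k}"
      using ab bij_betwE[OF bij_betw_transpose_diff[OF jk(1,2)]] by blast+
    ultimately show "?\<tau>' a < ?\<tau>' b" using strict_mono_onD[OF \<tau>(2)] by simp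
  qed
  have T': "last ` Rk \<subseteq> T" by (rule heaviest_ends_bij(2)[OF Ck Rk])
  have eq: "x j * link_det (C - {k}) \<tau> = - (x k * link_det (C - {j}) ?\<tau>')"
    by (rule link_det_exchange[OF C x jk(1,2)]) (use jk \<tau> T' in \<open>auto simp: bij_betw_def\<close>)
  note sk = heaviest_link_det_sign[OF Ck Rk \<tau>] and sj = heaviest_link_det_sign[OF Cj Rj \<tau>' mono']
  have x0: "x j \<noteq> 0" "x k \<noteq> 0" using x(2) jk by (auto simp: vsupp_def)
  have sgn_sv: "of_int (sign_vec x i) = sgn (x i)" for i by (simp add: sign_vec_def sgn_if)
  have sgn_k: "of_int (routing_sign \<sigma> (C - {k}) T Rk) = sgn (link_det (C - {k}) \<tau>)"
    using sk by (auto simp: sgn_if)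
  have sgn_j: "of_int (routing_sign \<sigma> (C - {j}) T Rj) = sgn (link_det (C - {j}) ?\<tau>')"
    using sj by (auto simp: sgn_if)
  have "sgn (x j) * sgn (link_det (C - {k}) \<tau>) = - (sgn (x k) * sgn (link_det (C - {j}) ?\<tau>'))"
    using arg_cong[OF eq, of sgn] by (simp add: sgn_mult sgn_minus)
  then have "real_of_int (sign_vec x j * routing_sign \<sigma> (C - {k}) T Rk)
      = real_of_int (- (sign_vec x k * routing_sign \<sigma> (C - {j}) T Rj))"
    by (simp add: sgn_sv sgn_k sgn_j)
  then show ?thesis by linarith
qed

text \<open>
  The alternation between neighbours propagates from the first element of the circuit; the global
  sign \<open>\<epsilon>\<close> is the one by which the normalisations at that element differ.
\<close>
lemma circuit_signature_sign_vec:
  assumes C: "C \<subseteq> V" and x: "x \<in> dependencies V" "vsupp x = C" "C \<noteq> {}"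
    and routable: "\<And>c. c \<in> C \<Longrightarrow> \<exists>R. routing D (C - {c}) T R"
  shows "circuit_signature D T \<sigma> lo 1 C = sign_vec x \<or> circuit_signature D T \<sigma> lo 1 C = - sign_vec x"
proof -
  let ?n = "card C" and ?c = "nth_elem C" and ?g = "circuit_signature D T \<sigma> lo 1 C"
  define R where "R = (\<lambda>i. max_routing D lo (C - {?c i}) T)"
  define s where "s = (\<lambda>i. routing_sign \<sigma> (C - {?c i}) T (R i))"
  have fin: "finite C" using C finite_V finite_subset by blast
  have n: "?n \<ge> 1" using fin x(3) by (simp add: Suc_leI card_gt_0_iff)
  have cC: "?c i \<in> C" if "i \<in> {1..?n}" for i using nth_elem_in[OF fin that] .
  have R: "heaviest (C - {?c i}) (R i)" if "i \<in> {1..?n}" for i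
    unfolding R_def using routable[OF cC[OF that]] heaviest_max_routing by blast
  have s: "s i * s i = 1" if i: "i \<in> {1..?n}" for i
  proof -
    have X: "C - {?c i} \<subseteq> V" using C by auto
    obtain \<tau> where "bij_betw \<tau> (C - {?c i}) (last ` R i)" "strict_mono_on (C - {?c i}) \<tau>"
      using heaviest_ends_bij(1)[OF X R[OF i]] by blast
    from heaviest_link_det_sign(1)[OF X R[OF i] this] show ?thesis by (auto simp: s_def)
  qed
  have alternate: "sign_vec x (?c i) * s (Suc i) = - (sign_vec x (?c (Suc i)) * s i)"
    if i: "i \<in> {1..?n}" "Suc i \<in> {1..?n}" for i
    unfolding s_def
  proof (rule adjacent_signs[OF C x(1,2) cC[OF i(1)] cC[OF i(2)] _ _ R[OF i(1)] R[OF i(2)]])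
    show "?c i < ?c (Suc i)" using nth_elem_less_iff[OF fin i] by simp
    fix a assume a: "a \<in> C" "a < ?c (Suc i)"
    obtain m where m: "m \<in> {1..?n}" "?c m = a" using obtain_index[OF fin a(1)] .
    have "m < Suc i" using nth_elem_less_iff[OF fin m(1) i(2)] m(2) a(2) by simp
    then show "a \<le> ?c i" using nth_elem_less_iff[OF fin i(1) m(1)] m(2) by (metis not_less less_Suc_eq_le)
  qed
  define \<epsilon> where "\<epsilon> = - (sign_vec x (?c 1) * s 1)"
  have sv: "sign_vec x (?c i) = \<epsilon> * ((-1) ^ i * s i)" if "1 \<le> i" "i \<le> ?n" for i
    using that
  proof (induction i rule: dec_induct)
    case base
    then show ?case using s[of 1] n by (simp add: \<epsilon>_def mult.assoc)
  next
    case (step i)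
    then have i: "i \<in> {1..?n}" "Suc i \<in> {1..?n}" by auto
    have "sign_vec x (?c (Suc i)) = sign_vec x (?c (Suc i)) * s i * s i" using s[OF i(1)] by (simp add: mult.assoc)
    also have "\<dots> = - (sign_vec x (?c i) * s (Suc i)) * s i"
      using alternate[OF i] by simp
    also have "\<dots> = \<epsilon> * ((-1) ^ Suc i * s (Suc i)) * (s i * s i)"
      using step.IH i by (simp add: mult_ac)
    finally show ?case using s[OF i(1)] by simp
  qed
  have one: "1 \<in> {1..?n}" using n by simp
  have g: "?g (?c i) = (-1) ^ i * s i" if i: "i \<in> {1..?n}" for i
  proof (cases "i = 1")
    case True
    then show ?thesis using cC[OF one] by (simp add: circuit_signature_def s_def R_def Let_def)
  next
    case False
    then have "?c i \<noteq> ?c 1" using nth_elem_eq_iff[OF fin i one] by simp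
    then show ?thesis using cC[OF i] elem_index_nth_elem[OF fin i]
      by (simp add: circuit_signature_def s_def R_def Let_def)
  qed
  have "sign_vec x e = \<epsilon> * ?g e" for e
  proof (cases "e \<in> C")
    case True
    obtain i where i: "i \<in> {1..?n}" "?c i = e" using obtain_index[OF fin True] .
    then show ?thesis using sv[of i] g[OF i(1)] by simp
  next
    case False
    then have "x e = 0" using x(2) by (auto simp: vsupp_def)
    then show ?thesis using False by (simp add: sign_vec_def circuit_signature_def)
  qed
  moreover have "\<epsilon> = 1 \<or> \<epsilon> = -1"
  proof -
    have "x (?c 1) \<noteq> 0" using cC[OF one] x(2) by (auto simp: vsupp_def)
    then have "sign_vec x (?c 1) * sign_vec x (?c 1) = 1" by (simp add: sign_vec_def)
    then have "\<epsilon> * \<epsilon> = 1" using s[OF one] by (simp add: \<epsilon>_def mult_ac)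
    then show ?thesis by (simp add: square_eq_1_iff)
  qed
  ultimately show ?thesis by (auto simp: fun_eq_iff)
qed

text \<open>
  The circuits of the gammoid are the supports of the elementary dependencies, and for each of them
  both signs occur on either side.
\<close>
lemma signed_circuits_eq:
  assumes E: "E \<subseteq> V"
  shows "(\<Union>C \<in> circuits (gammoid D T E). {circuit_signature D T \<sigma> lo 1 C, - circuit_signature D T \<sigma> lo 1 C})
    = sign_vec ` {x. elementary (dependencies E) x}" (is "?L = ?R")
proof -
  interpret coordinate_subspace E "dependencies E" by (rule dependencies_subspace[OF E])
  have circ: "circuits (gammoid D T E) = vsupp ` {x. elementary (dependencies E) x}"
    by (rule circuits_free_sets) (simp_all add: gammoid_indeps[OF E], simp add: gammoid_def)
  have sig: "{circuit_signature D T \<sigma> lo 1 (vsupp x), - circuit_signature D T \<sigma> lo 1 (vsupp x)} = {sign_vec x, - sign_vec x}"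
    if x: "elementary (dependencies E) x" for x
  proof -
    have xd: "x \<in> dependencies E" using elementaryD(1)[OF x] .
    have CE: "vsupp x \<subseteq> E" using supp_subset[OF xd] .
    have "\<exists>R. routing D (vsupp x - {c}) T R" if "c \<in> vsupp x" for c
    proof -
      have "vsupp x \<in> circuits (gammoid D T E)" using circ x by blast
      moreover have "vsupp x - {c} \<subset> vsupp x" using that by blast
      ultimately have "vsupp x - {c} \<in> indeps (gammoid D T E)" unfolding circuits_def by blast
      then show ?thesis by (simp add: gammoid_def)
    qed
    then have "circuit_signature D T \<sigma> lo 1 (vsupp x) = sign_vec x \<or> circuit_signature D T \<sigma> lo 1 (vsupp x) = - sign_vec x"
      using CE E xd dependencies_mono[OF E] elementaryD(2)[OF x]
      by (intro circuit_signature_sign_vec) auto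
    then show ?thesis by auto
  qed
  have "- sign_vec x \<in> ?R" if "elementary (dependencies E) x" for x
    using elementary_scale[OF that, of "-1"] unfolding sign_vec_uminus[of x, symmetric] by simp
  then have "(\<Union>x\<in>{x. elementary (dependencies E) x}. {sign_vec x, - sign_vec x}) = ?R" by blast
  moreover have "?L = (\<Union>x\<in>{x. elementary (dependencies E) x}. {sign_vec x, - sign_vec x})"
    unfolding circ using sig by simp
  ultimately show ?thesis by simp
qed

end

section \<open>The oriented gammoid\<close>

theorem lemma2p9:
  fixes D :: "'v::linorder pair_pre_digraph"
    and \<sigma> :: "'v \<times> 'v \<Rightarrow> int"
    and lo :: "('v \<times> 'v) rel"
    and T E :: "'v set"
  assumes "pair_fin_digraph D"
    and "acyclic_digraph D"
    and "heavy_arc_signature D \<sigma> lo"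
    and "T \<subseteq> pverts D"
    and "E \<subseteq> pverts D"
  shows "\<exists>!\<O>. oriented_matroid \<O> \<and> om_ground \<O> = E \<and>
           signed_circuits \<O> =
             (\<Union>C \<in> circuits (gammoid D T E).
                {circuit_signature D T \<sigma> lo 1 C, - circuit_signature D T \<sigma> lo 1 C})"
proof -
  interpret heavy_digraph D \<sigma> lo T
    by (intro heavy_digraph.intro acyclic_pair_digraph.intro heavy_digraph_axioms.intro assms(1-4))
  interpret coordinate_subspace E "dependencies E" by (rule dependencies_subspace[OF assms(5)])
  show ?thesis unfolding signed_circuits_eq[OF assms(5)] by (rule ex1_oriented_matroid)
qed

end
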